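(* Let $(M,J,g)$ be an LCSKT manifold with Bismut torsion $3$-form $H$. Then $M$ has an open cover $\{U_i\}$ and a family $\{f_i\}$ of smooth functions $f_i:U_i\to\mathbb R$ such that each local $3$-form $(e^{-f_i}H)|_{U_i}$ is $d$-closed.
   Context: $(M,J,g)$ is a Hermitian manifold of real dimension $2n$: $J$ is an (integrable) complex structure and $g$ a Riemannian metric with $g(JX,JY)=g(X,Y)$. The fundamental form is $\Omega(X,Y)=g(JX,Y)$ and the Bismut torsion $3$-form is $H=d^c\Omega$ with $d^c=i(\overline\partial-\partial)$, i.e. $H(X,Y,Z)=-d\Omega(JX,JY,JZ)$. $(M,J,g)$ is LCSKT (locally conformal SKT) if there exists a $d$-closed (non-zero) $1$-form $\alpha$ on $M$ with $dH=\alpha\wedge H$. *)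

theory Defs
  imports "HOL-Analysis.Analysis"
begin

section \<open>Smooth maps between open sets of normed spaces\<close>

text \<open>For open \<open>S\<close> in a finite-dimensional space, \<open>Ck_on k S f\<close> says that \<open>f\<close> is \<open>k\<close> times
  continuously differentiable on \<open>S\<close>; derivatives are taken one direction at a time.\<close>

primrec Ck_on ::
    "nat \<Rightarrow> 'v::real_normed_vector set \<Rightarrow> ('v \<Rightarrow> 'w::real_normed_vector) \<Rightarrow> bool" where
  "Ck_on 0 S f \<longleftrightarrow> continuous_on S f"
| "Ck_on (Suc k) S f \<longleftrightarrow>
     (\<forall>x\<in>S. f differentiable (at x)) \<and>
     (\<forall>v. Ck_on k S (\<lambda>x. frechet_derivative f (at x) v))"

definition smooth_on :: "'v::real_normed_vector set \<Rightarrow> ('v \<Rightarrow> 'w::real_normed_vector) \<Rightarrow> bool" where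
  "smooth_on S f \<longleftrightarrow> (\<forall>k. Ck_on k S f)"


section \<open>Smooth manifolds\<close>

text \<open>A chart is a pair of its domain and its coordinate map; the values of the coordinate map
  off the domain are irrelevant.\<close>

type_synonym ('a, 'v) chart = "'a set \<times> ('a \<Rightarrow> 'v)"

abbreviation cdom :: "('a, 'v) chart \<Rightarrow> 'a set" where
  "cdom c \<equiv> fst c"

abbreviation cmap :: "('a, 'v) chart \<Rightarrow> 'a \<Rightarrow> 'v" where
  "cmap c \<equiv> snd c"

abbreviation cinv :: "('a, 'v) chart \<Rightarrow> 'v \<Rightarrow> 'a" where
  "cinv c \<equiv> inv_into (cdom c) (cmap c)"

definition is_chart :: "'a topology \<Rightarrow> ('a, 'v::euclidean_space) chart \<Rightarrow> bool" where
  "is_chart M c \<longleftrightarrow>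
     openin M (cdom c) \<and> open (cmap c ` cdom c) \<and>
     homeomorphic_map (subtopology M (cdom c)) (top_of_set (cmap c ` cdom c)) (cmap c)"

definition smooth_transition ::
    "('a, 'v::euclidean_space) chart \<Rightarrow> ('a, 'v) chart \<Rightarrow> bool" where
  "smooth_transition c c' \<longleftrightarrow>
     smooth_on (cmap c ` (cdom c \<inter> cdom c')) (cmap c' \<circ> cinv c)"

text \<open>\<open>A\<close> is a maximal smooth atlas; the dimension is that of the model space \<open>'v\<close>.\<close>

definition smooth_manifold :: "'a topology \<Rightarrow> ('a, 'v::euclidean_space) chart set \<Rightarrow> bool" where
  "smooth_manifold M A \<longleftrightarrow>
     Hausdorff_space M \<and> second_countable M \<and>
     (\<forall>c\<in>A. is_chart M c) \<and>
     (\<Union>c\<in>A. cdom c) = topspace M \<and>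
     (\<forall>c\<in>A. \<forall>c'\<in>A. smooth_transition c c') \<and>
     (\<forall>c. is_chart M c \<and> (\<forall>c'\<in>A. smooth_transition c c' \<and> smooth_transition c' c) \<longrightarrow> c \<in> A)"

definition charts_at :: "('a, 'v) chart set \<Rightarrow> 'a \<Rightarrow> ('a, 'v) chart set" where
  "charts_at A p = {c \<in> A. p \<in> cdom c}"

definition smooth_fun_on ::
    "('a, 'v::euclidean_space) chart set \<Rightarrow> 'a set \<Rightarrow> ('a \<Rightarrow> real) \<Rightarrow> bool" where
  "smooth_fun_on A U f \<longleftrightarrow> (\<forall>c\<in>A. smooth_on (cmap c ` (U \<inter> cdom c)) (f \<circ> cinv c))"


section \<open>Tangent vectors\<close>

text \<open>A tangent vector at \<open>p\<close> is the family of its components \<open>X c\<close> in all charts \<open>c\<close> around \<open>p\<close>,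
  related by the derivatives of the transition maps. Components in the remaining charts are
  set to zero, so that tangent vectors are equal iff their components around \<open>p\<close> agree.\<close>

type_synonym ('a, 'v) tvec = "('a, 'v) chart \<Rightarrow> 'v"

definition tangent_space ::
    "('a, 'v::euclidean_space) chart set \<Rightarrow> 'a \<Rightarrow> ('a, 'v) tvec set" where
  "tangent_space A p =
     {X. (\<forall>c\<in>charts_at A p. \<forall>c'\<in>charts_at A p.
            X c' = frechet_derivative (cmap c' \<circ> cinv c) (at (cmap c p)) (X c)) \<and>
         (\<forall>c. c \<notin> charts_at A p \<longrightarrow> X c = 0)}"

text \<open>The tangent vector at \<open>p\<close> with component \<open>a\<close> in the chart \<open>c\<close>. For a chart \<open>c\<close> around \<open>p\<close>
  this is the linear isomorphism from \<open>'v\<close> to the tangent space at \<open>p\<close>.\<close>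

definition coord_vec ::
    "('a, 'v::euclidean_space) chart set \<Rightarrow> ('a, 'v) chart \<Rightarrow> 'a \<Rightarrow> 'v \<Rightarrow> ('a, 'v) tvec" where
  "coord_vec A c p a =
     (\<lambda>c'. if c' \<in> charts_at A p
           then frechet_derivative (cmap c' \<circ> cinv c) (at (cmap c p)) a else 0)"


section \<open>Differential forms\<close>

text \<open>A \<open>k\<close>-form takes a point and a list of \<open>k\<close> tangent vectors at it; only these values matter.\<close>

type_synonym ('a, 'v) dform = "'a \<Rightarrow> ('a, 'v) tvec list \<Rightarrow> real"

text \<open>The local expression of a form in the chart \<open>c\<close>, a form on the open set \<open>cmap c ` cdom c\<close>.\<close>

definition form_coord ::
    "('a, 'v::euclidean_space) chart set \<Rightarrow> ('a, 'v) chart \<Rightarrow> ('a, 'v) dform \<Rightarrow> 'v \<Rightarrow> 'v list \<Rightarrow> real"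
    where
  "form_coord A c \<omega> x as = \<omega> (cinv c x) (map (coord_vec A c (cinv c x)) as)"

definition multilinear_form :: "nat \<Rightarrow> ('v::real_vector list \<Rightarrow> real) \<Rightarrow> bool" where
  "multilinear_form k \<phi> \<longleftrightarrow>
     (\<forall>as i. length as = k \<and> i < k \<longrightarrow> linear (\<lambda>a. \<phi> (as[i := a])))"

definition alternating_form :: "nat \<Rightarrow> ('v list \<Rightarrow> real) \<Rightarrow> bool" where
  "alternating_form k \<phi> \<longleftrightarrow>
     (\<forall>as i j. length as = k \<and> i < j \<and> j < k \<and> as ! i = as ! j \<longrightarrow> \<phi> as = 0)"

definition smooth_form_on ::
    "('a, 'v::euclidean_space) chart set \<Rightarrow> 'a set \<Rightarrow> nat \<Rightarrow> ('a, 'v) dform \<Rightarrow> bool" where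
  "smooth_form_on A U k \<omega> \<longleftrightarrow>
     (\<forall>c\<in>A.
        (\<forall>x \<in> cmap c ` (U \<inter> cdom c).
           multilinear_form k (form_coord A c \<omega> x) \<and> alternating_form k (form_coord A c \<omega> x)) \<and>
        (\<forall>as. length as = k \<longrightarrow>
           smooth_on (cmap c ` (U \<inter> cdom c)) (\<lambda>x. form_coord A c \<omega> x as)))"

definition omit :: "nat \<Rightarrow> 'b list \<Rightarrow> 'b list" where
  "omit i xs = take i xs @ drop (Suc i) xs"

text \<open>Exterior derivative: in local coordinates,
  \<open>d\<omega>(X\<^sub>0,\<dots>,X\<^sub>k) = \<Sum>\<^sub>i (-1)\<^sup>i (D\<omega> X\<^sub>i)(X\<^sub>0,\<dots>,X\<^sub>i\<^sub>-\<^sub>1,X\<^sub>i\<^sub>+\<^sub>1,\<dots>,X\<^sub>k)\<close>. For smooth forms this does not depend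
  on the chart around \<open>p\<close>, so any chart may be used. Since only the germ of \<open>\<omega>\<close> at \<open>p\<close> enters,
  it also applies to forms defined near \<open>p\<close> only.\<close>

definition ext_deriv ::
    "('a, 'v::euclidean_space) chart set \<Rightarrow> ('a, 'v) dform \<Rightarrow> ('a, 'v) dform" where
  "ext_deriv A \<omega> p Xs =
     (let c = (SOME c. c \<in> charts_at A p) in
      \<Sum>i<length Xs. (-1) ^ i *
        frechet_derivative (\<lambda>x. form_coord A c \<omega> x (map (\<lambda>X. X c) (omit i Xs)))
          (at (cmap c p)) ((Xs ! i) c))"

text \<open>Wedge product of a 1-form with a form of any degree (shuffle convention, matching
  \<^const>\<open>ext_deriv\<close>: \<open>d(f\<omega>) = df \<and> \<omega> + f d\<omega>\<close>).\<close>

definition wedge1 :: "('a, 'v) dform \<Rightarrow> ('a, 'v) dform \<Rightarrow> ('a, 'v) dform" where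
  "wedge1 \<alpha> \<omega> p Xs = (\<Sum>i<length Xs. (-1) ^ i * \<alpha> p [Xs ! i] * \<omega> p (omit i Xs))"

definition form_eq_on ::
    "('a, 'v::euclidean_space) chart set \<Rightarrow> 'a set \<Rightarrow> nat \<Rightarrow> ('a, 'v) dform \<Rightarrow> ('a, 'v) dform \<Rightarrow> bool"
    where
  "form_eq_on A U k \<omega> \<eta> \<longleftrightarrow>
     (\<forall>p\<in>U. \<forall>Xs. length Xs = k \<and> set Xs \<subseteq> tangent_space A p \<longrightarrow> \<omega> p Xs = \<eta> p Xs)"

definition closed_form_on ::
    "('a, 'v::euclidean_space) chart set \<Rightarrow> 'a set \<Rightarrow> nat \<Rightarrow> ('a, 'v) dform \<Rightarrow> bool" where
  "closed_form_on A U k \<omega> \<longleftrightarrow>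
     smooth_form_on A U k \<omega> \<and> form_eq_on A U (Suc k) (ext_deriv A \<omega>) (\<lambda>p Xs. 0)"


section \<open>Hermitian manifolds\<close>

type_synonym ('a, 'v) metric_field = "'a \<Rightarrow> ('a, 'v) tvec \<Rightarrow> ('a, 'v) tvec \<Rightarrow> real"
type_synonym ('a, 'v) endo_field = "'a \<Rightarrow> ('a, 'v) tvec \<Rightarrow> ('a, 'v) tvec"

definition riemannian_metric ::
    "'a topology \<Rightarrow> ('a, 'v::euclidean_space) chart set \<Rightarrow> ('a, 'v) metric_field \<Rightarrow> bool" where
  "riemannian_metric M A g \<longleftrightarrow>
     (\<forall>p\<in>topspace M. \<forall>X\<in>tangent_space A p. \<forall>Y\<in>tangent_space A p.
        g p X Y = g p Y X \<and> (X \<noteq> (\<lambda>c. 0) \<longrightarrow> 0 < g p X X)) \<and>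
     (\<forall>c\<in>A. \<forall>p\<in>cdom c. bilinear (\<lambda>a b. g p (coord_vec A c p a) (coord_vec A c p b))) \<and>
     (\<forall>c\<in>A. \<forall>a b. smooth_on (cmap c ` cdom c)
        (\<lambda>x. g (cinv c x) (coord_vec A c (cinv c x) a) (coord_vec A c (cinv c x) b)))"

definition almost_complex_structure ::
    "'a topology \<Rightarrow> ('a, 'v::euclidean_space) chart set \<Rightarrow> ('a, 'v) endo_field \<Rightarrow> bool" where
  "almost_complex_structure M A J \<longleftrightarrow>
     (\<forall>p\<in>topspace M. \<forall>X\<in>tangent_space A p.
        J p X \<in> tangent_space A p \<and> J p (J p X) = (\<lambda>c. - X c)) \<and>
     (\<forall>c\<in>A. \<forall>p\<in>cdom c. linear (\<lambda>a. J p (coord_vec A c p a) c)) \<and>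
     (\<forall>c\<in>A. \<forall>a. smooth_on (cmap c ` cdom c)
        (\<lambda>x. J (cinv c x) (coord_vec A c (cinv c x) a) c))"

text \<open>Integrability: around every point there are holomorphic coordinates, that is, a chart
  of the smooth structure in which \<open>J\<close> is multiplication by \<open>\<i>\<close> on \<open>\<complex>\<^sup>n\<close>.\<close>

definition complex_structure ::
    "'a topology \<Rightarrow> ('a, complex ^ 'n) chart set \<Rightarrow> ('a, complex ^ 'n) endo_field \<Rightarrow> bool" where
  "complex_structure M A J \<longleftrightarrow>
     almost_complex_structure M A J \<and>
     (\<forall>p\<in>topspace M. \<exists>c\<in>charts_at A p.
        \<forall>q\<in>cdom c. \<forall>X\<in>tangent_space A q. J q X c = \<i> *s X c)"

text \<open>The real dimension is \<open>DIM(complex ^ 'n) = 2 * CARD('n)\<close>.\<close>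

definition hermitian_manifold ::
    "'a topology \<Rightarrow> ('a, complex ^ 'n) chart set \<Rightarrow> ('a, complex ^ 'n) endo_field \<Rightarrow>
     ('a, complex ^ 'n) metric_field \<Rightarrow> bool" where
  "hermitian_manifold M A J g \<longleftrightarrow>
     smooth_manifold M A \<and> complex_structure M A J \<and> riemannian_metric M A g \<and>
     (\<forall>p\<in>topspace M. \<forall>X\<in>tangent_space A p. \<forall>Y\<in>tangent_space A p.
        g p (J p X) (J p Y) = g p X Y)"

definition fundamental_form ::
    "('a, 'v) endo_field \<Rightarrow> ('a, 'v) metric_field \<Rightarrow> ('a, 'v) dform" where
  "fundamental_form J g p Xs = g p (J p (Xs ! 0)) (Xs ! 1)"

text \<open>\<open>H = d\<^sup>c\<Omega>\<close>, that is, \<open>H(X,Y,Z) = - d\<Omega>(JX,JY,JZ)\<close>.\<close>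

definition bismut_torsion ::
    "('a, 'v::euclidean_space) chart set \<Rightarrow> ('a, 'v) endo_field \<Rightarrow> ('a, 'v) metric_field \<Rightarrow>
     ('a, 'v) dform" where
  "bismut_torsion A J g p Xs = - ext_deriv A (fundamental_form J g) p (map (J p) Xs)"

text \<open>``Non-zero'' means that \<open>\<alpha>\<close> is not identically zero; it may have zeros.\<close>

definition LCSKT ::
    "'a topology \<Rightarrow> ('a, complex ^ 'n) chart set \<Rightarrow> ('a, complex ^ 'n) endo_field \<Rightarrow>
     ('a, complex ^ 'n) metric_field \<Rightarrow> bool" where
  "LCSKT M A J g \<longleftrightarrow>
     hermitian_manifold M A J g \<and>
     (\<exists>\<alpha>. closed_form_on A (topspace M) 1 \<alpha> \<and>
          \<not> form_eq_on A (topspace M) 1 \<alpha> (\<lambda>p Xs. 0) \<and>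
          form_eq_on A (topspace M) 4 (ext_deriv A (bismut_torsion A J g))
            (wedge1 \<alpha> (bismut_torsion A J g)))"

end

theory Submission
  imports Defs
begin

text \<open>
  Let \<open>dH = \<alpha> \<and> H\<close> with \<open>\<alpha>\<close> closed. Near any point the Poincare lemma writes \<open>\<alpha>\<close> as \<open>df\<close>. The
  Leibniz rule then gives
  \<open>d(e\<^sup>-\<^sup>f H) = e\<^sup>-\<^sup>f (dH - df \<and> H) = e\<^sup>-\<^sup>f (dH - \<alpha> \<and> H) = 0\<close>, and neighbourhoods of this
  kind cover the manifold. The lemmas carrying this argument are \<open>closed_one_form_locally_exact\<close>
  and \<open>ext_deriv_exp_mult\<close>.

  The substance lies in the coordinates. The exterior derivative at a point is computed in an
  arbitrarily chosen chart, and neighbouring points may use unrelated charts. Two steps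
  therefore need \<open>d\<close> to be independent of the chart (\<open>ext_deriv_in_chart\<close>): closedness of the
  \<open>1\<close>-form \<open>\<alpha>\<close> has to be read in one fixed chart on a whole ball before it can be integrated,
  and the smoothness of \<open>H = - d\<Omega>(J\<cdot>, J\<cdot>, J\<cdot>)\<close> involves \<open>d\<close> of the \<open>2\<close>-form \<open>\<Omega>\<close> in
  one chart at all points near a given one. Independence of the chart is naturality of \<open>d\<close> under
  a transition map \<open>\<tau>\<close>: differentiating \<open>\<tau>\<^sup>*\<psi>\<close> produces, besides the pullback of \<open>d\<psi>\<close>, terms containing the second
  derivative of \<open>\<tau>\<close>, which cancel because that derivative is symmetric and \<open>\<psi>\<close> is alternating
  (\<open>local_ext_deriv_pullback_1\<close>, \<open>local_ext_deriv_pullback_2\<close>). The Leibniz rule for the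
  \<open>3\<close>-form \<open>e\<^sup>-\<^sup>f H\<close>, on the other hand, is pointwise and can be checked in whatever chart
  defines \<open>d\<close> at the point.
\<close>

section \<open>Calculus of smooth maps\<close>

lemma frechet_derivative_cong_open:
  assumes "open S" "x \<in> S" "\<And>y. y \<in> S \<Longrightarrow> f y = g y"
  shows "frechet_derivative f (at x) = frechet_derivative g (at x)"
proof -
  have "(f has_derivative D) (at x) \<longleftrightarrow> (g has_derivative D) (at x)" for D
    using has_derivative_transform_within_open[of f D x UNIV S g]
      has_derivative_transform_within_open[of g D x UNIV S f] assms by auto
  then show ?thesis
    unfolding frechet_derivative_def by simp
qed

lemma differentiable_cong_open:
  assumes "open S" "x \<in> S" "\<And>y. y \<in> S \<Longrightarrow> f y = g y" "f differentiable (at x)"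
  shows "g differentiable (at x)"
  using assms has_derivative_transform_within_open[of f _ x UNIV S g]
  unfolding differentiable_def by blast

lemma Ck_on_cong:
  assumes "open S" "\<And>y. y \<in> S \<Longrightarrow> f y = g y" "Ck_on k S f"
  shows "Ck_on k S g"
  using assms(2,3)
proof (induction k arbitrary: f g)
  case 0
  then show ?case by (simp cong: continuous_on_cong)
next
  case (Suc k)
  show ?case
    unfolding Ck_on.simps
  proof (intro conjI ballI allI)
    fix x assume "x \<in> S"
    then show "g differentiable (at x)"
      using Suc.prems differentiable_cong_open[OF \<open>open S\<close>, of x f g] by auto
  next
    fix v
    show "Ck_on k S (\<lambda>x. frechet_derivative g (at x) v)"
    proof (rule Suc.IH)
      show "Ck_on k S (\<lambda>x. frechet_derivative f (at x) v)"
        using Suc.prems by simp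
      show "frechet_derivative f (at y) v = frechet_derivative g (at y) v" if "y \<in> S" for y
        using frechet_derivative_cong_open[OF \<open>open S\<close> that, of f g] Suc.prems by simp
    qed
  qed
qed

lemma Ck_on_subset: "Ck_on k S f \<Longrightarrow> T \<subseteq> S \<Longrightarrow> Ck_on k T f"
  by (induction k arbitrary: f) (auto intro: continuous_on_subset)

lemma Ck_on_Suc_imp: "Ck_on (Suc k) S f \<Longrightarrow> Ck_on k S f"
proof (induction k arbitrary: f)
  case 0
  then show ?case
    by (auto intro!: continuous_at_imp_continuous_on differentiable_imp_continuous_within)
next
  case (Suc k)
  have "Ck_on k S (\<lambda>x. frechet_derivative f (at x) v)" for v
    using Suc.prems by (intro Suc.IH) simp
  then show ?case using Suc.prems by simp
qed

text \<open>The way to raise the order of smoothness: any explicit derivative may be used in place of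
  \<^const>\<open>frechet_derivative\<close>. Closure under sums, bounded linear and bilinear
  maps and composition is proved by induction on \<open>k\<close> with this rule.\<close>

lemma Ck_on_Suc_if_has_derivative:
  assumes "open S" "\<And>x. x \<in> S \<Longrightarrow> (f has_derivative f' x) (at x)"
    and "\<And>v. Ck_on k S (\<lambda>x. f' x v)"
  shows "Ck_on (Suc k) S f"
  unfolding Ck_on.simps
proof (intro conjI ballI allI)
  show "f differentiable (at x)" if "x \<in> S" for x
    using assms(2)[OF that] by (rule differentiableI)
  show "Ck_on k S (\<lambda>x. frechet_derivative f (at x) v)" for v
    by (rule Ck_on_cong[OF assms(1) _ assms(3)[of v]])
      (simp add: frechet_derivative_at[OF assms(2), symmetric])
qed

lemma Ck_on_Suc_has_derivative:
  assumes "Ck_on (Suc k) S f" "x \<in> S"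
  shows "(f has_derivative frechet_derivative f (at x)) (at x)"
  using assms by (simp flip: frechet_derivative_works)

lemma Ck_on_Suc_deriv: "Ck_on (Suc k) S f \<Longrightarrow> Ck_on k S (\<lambda>x. frechet_derivative f (at x) v)"
  by simp

lemma Ck_on_const: "Ck_on k S (\<lambda>x. c)"
  by (induction k arbitrary: c) auto

lemma Ck_on_bounded_linear:
  assumes "bounded_linear h" "open S" "Ck_on k S f"
  shows "Ck_on k S (\<lambda>x. h (f x))"
  using assms(3)
proof (induction k arbitrary: f)
  case 0
  then show ?case
    using bounded_linear.continuous_on[OF assms(1)] by simp
next
  case (Suc k)
  show ?case
  proof (rule Ck_on_Suc_if_has_derivative[OF assms(2)])
    show "((\<lambda>x. h (f x)) has_derivative (\<lambda>v. h (frechet_derivative f (at x) v))) (at x)"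
      if "x \<in> S" for x
      by (rule bounded_linear.has_derivative[OF assms(1) Ck_on_Suc_has_derivative[OF Suc.prems that]])
    show "Ck_on k S (\<lambda>x. h (frechet_derivative f (at x) v))" for v
      by (rule Suc.IH[OF Ck_on_Suc_deriv[OF Suc.prems]])
  qed
qed

lemma Ck_on_add:
  assumes "open S" "Ck_on k S f" "Ck_on k S g"
  shows "Ck_on k S (\<lambda>x. f x + g x)"
  using assms(2,3)
proof (induction k arbitrary: f g)
  case 0
  then show ?case by (simp add: continuous_on_add)
next
  case (Suc k)
  show ?case
  proof (rule Ck_on_Suc_if_has_derivative[OF assms(1)])
    show "((\<lambda>x. f x + g x) has_derivative
        (\<lambda>v. frechet_derivative f (at x) v + frechet_derivative g (at x) v)) (at x)"
      if "x \<in> S" for x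
      using Suc.prems that by (intro has_derivative_add Ck_on_Suc_has_derivative)
    show "Ck_on k S (\<lambda>x. frechet_derivative f (at x) v + frechet_derivative g (at x) v)" for v
      by (intro Suc.IH Ck_on_Suc_deriv Suc.prems)
  qed
qed

lemma Ck_on_sum:
  assumes "open S" "\<And>i. i \<in> I \<Longrightarrow> Ck_on k S (f i)"
  shows "Ck_on k S (\<lambda>x. \<Sum>i\<in>I. f i x)"
  using assms(2)
  by (induction I rule: infinite_finite_induct) (auto intro: Ck_on_const Ck_on_add[OF assms(1)])

lemma Ck_on_bounded_bilinear:
  assumes "bounded_bilinear h" "open S" "Ck_on k S f" "Ck_on k S g"
  shows "Ck_on k S (\<lambda>x. h (f x) (g x))"
  using assms(3,4)
proof (induction k arbitrary: f g)
  case 0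
  then show ?case
    using bounded_bilinear.continuous_on[OF assms(1)] by simp
next
  case (Suc k)
  show ?case
  proof (rule Ck_on_Suc_if_has_derivative[OF assms(2)])
    show "((\<lambda>x. h (f x) (g x)) has_derivative
        (\<lambda>v. h (f x) (frechet_derivative g (at x) v) + h (frechet_derivative f (at x) v) (g x))) (at x)"
      if "x \<in> S" for x
      using Suc.prems that
      by (intro bounded_bilinear.FDERIV[OF assms(1)] Ck_on_Suc_has_derivative)
    show "Ck_on k S (\<lambda>x. h (f x) (frechet_derivative g (at x) v) +
        h (frechet_derivative f (at x) v) (g x))" for v
      by (intro Ck_on_add[OF assms(2)] Suc.IH Ck_on_Suc_deriv Suc.prems)
        (rule Ck_on_Suc_imp, rule Suc.prems)+
  qed
qed

lemma linear_basis_expansion: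
  fixes a :: "'v::euclidean_space \<Rightarrow> 'w::real_vector"
  assumes "linear a"
  shows "a w = (\<Sum>b\<in>Basis. (w \<bullet> b) *\<^sub>R a b)"
proof -
  have "a w = a (\<Sum>b\<in>Basis. (w \<bullet> b) *\<^sub>R b)"
    by (simp only: euclidean_representation)
  then show ?thesis
    by (simp only: linear_sum[OF assms] linear_cmul[OF assms])
qed

text \<open>Expanding the argument in a basis reduces the claim to fixed vectors. Derivatives along varying
  vectors are handled by this lemma, first of all in the chain rule for \<^const>\<open>Ck_on\<close>.\<close>

lemma Ck_on_linear_apply:
  fixes a :: "'u::real_normed_vector \<Rightarrow> 'v::euclidean_space \<Rightarrow> 'w::real_normed_vector"
  assumes "open S" "\<And>y. y \<in> S \<Longrightarrow> linear (a y)" "\<And>v. Ck_on k S (\<lambda>y. a y v)" "Ck_on k S w"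
  shows "Ck_on k S (\<lambda>y. a y (w y))"
proof (rule Ck_on_cong[OF assms(1)])
  show "(\<Sum>b\<in>Basis. (w y \<bullet> b) *\<^sub>R a y b) = a y (w y)" if "y \<in> S" for y
    by (rule linear_basis_expansion[OF assms(2)[OF that], symmetric])
  show "Ck_on k S (\<lambda>y. \<Sum>b\<in>Basis. (w y \<bullet> b) *\<^sub>R a y b)"
    by (intro Ck_on_sum[OF assms(1)] Ck_on_bounded_bilinear[OF bounded_bilinear_scaleR assms(1)] assms(3)
      Ck_on_bounded_linear[OF bounded_linear_inner_left assms(1) assms(4)])
qed

lemma Ck_on_compose:
  fixes f :: "'u::real_normed_vector \<Rightarrow> 'v::euclidean_space"
  assumes "open S" "f ` S \<subseteq> T" "Ck_on k S f" "Ck_on k T g"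
  shows "Ck_on k S (\<lambda>x. g (f x))"
  using assms(3,4)
proof (induction k arbitrary: g)
  case 0
  then show ?case
    using continuous_on_compose2[of T g S f] assms(2) by auto
next
  case (Suc k)
  have f: "Ck_on k S f"
    by (rule Ck_on_Suc_imp[OF Suc.prems(1)])
  show ?case
  proof (rule Ck_on_Suc_if_has_derivative[OF assms(1)])
    show "((\<lambda>x. g (f x)) has_derivative
        (\<lambda>v. frechet_derivative g (at (f x)) (frechet_derivative f (at x) v))) (at x)"
      if "x \<in> S" for x
      using that assms(2)
      by (intro has_derivative_compose[OF Ck_on_Suc_has_derivative[OF Suc.prems(1)]]
          Ck_on_Suc_has_derivative[OF Suc.prems(2)]) auto
    show "Ck_on k S (\<lambda>x. frechet_derivative g (at (f x)) (frechet_derivative f (at x) v))" for v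
    proof (rule Ck_on_linear_apply[OF assms(1)])
      show "linear (frechet_derivative g (at (f y)))" if "y \<in> S" for y
        using that assms(2) Ck_on_Suc_has_derivative[OF Suc.prems(2), of "f y"]
        by (intro has_derivative_linear) auto
      show "Ck_on k S (\<lambda>y. frechet_derivative g (at (f y)) w)" for w
        by (rule Suc.IH[OF f Ck_on_Suc_deriv[OF Suc.prems(2)]])
      show "Ck_on k S (\<lambda>y. frechet_derivative f (at y) v)"
        by (rule Ck_on_Suc_deriv[OF Suc.prems(1)])
    qed
  qed
qed

lemma smooth_on_cong:
  "open S \<Longrightarrow> (\<And>y. y \<in> S \<Longrightarrow> f y = g y) \<Longrightarrow> smooth_on S f \<Longrightarrow> smooth_on S g"
  unfolding smooth_on_def using Ck_on_cong[of S f g] by blast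

lemma smooth_on_subset: "smooth_on S f \<Longrightarrow> T \<subseteq> S \<Longrightarrow> smooth_on T f"
  unfolding smooth_on_def using Ck_on_subset by blast

lemma smooth_on_has_derivative:
  "smooth_on S f \<Longrightarrow> x \<in> S \<Longrightarrow> (f has_derivative frechet_derivative f (at x)) (at x)"
  unfolding smooth_on_def using Ck_on_Suc_has_derivative by blast

lemma smooth_on_deriv:
  "smooth_on S f \<Longrightarrow> smooth_on S (\<lambda>x. frechet_derivative f (at x) v)"
  unfolding smooth_on_def using Ck_on_Suc_deriv by blast

lemma smooth_on_continuous_on: "smooth_on S f \<Longrightarrow> continuous_on S f"
  unfolding smooth_on_def using Ck_on.simps(1) by blast

lemma smooth_on_if_has_derivative:
  assumes "open S" "\<And>x. x \<in> S \<Longrightarrow> (f has_derivative f' x) (at x)"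
    and "\<And>v. smooth_on S (\<lambda>x. f' x v)"
  shows "smooth_on S f"
  using Ck_on_Suc_if_has_derivative[OF assms(1,2)] assms(3) Ck_on_Suc_imp
  unfolding smooth_on_def by blast

lemma smooth_on_const: "smooth_on S (\<lambda>x. c)"
  by (simp add: smooth_on_def Ck_on_const)

lemma smooth_on_bounded_linear:
  "bounded_linear h \<Longrightarrow> open S \<Longrightarrow> smooth_on S f \<Longrightarrow> smooth_on S (\<lambda>x. h (f x))"
  by (simp add: smooth_on_def Ck_on_bounded_linear)

lemma smooth_on_minus: "open S \<Longrightarrow> smooth_on S f \<Longrightarrow> smooth_on S (\<lambda>x. - f x)"
  by (rule smooth_on_bounded_linear[OF bounded_linear_minus[OF bounded_linear_ident]])

lemma smooth_on_add:
  "open S \<Longrightarrow> smooth_on S f \<Longrightarrow> smooth_on S g \<Longrightarrow> smooth_on S (\<lambda>x. f x + g x)"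
  by (simp add: smooth_on_def Ck_on_add)

lemma smooth_on_mult:
  fixes f g :: "'u::real_normed_vector \<Rightarrow> real"
  shows "open S \<Longrightarrow> smooth_on S f \<Longrightarrow> smooth_on S g \<Longrightarrow> smooth_on S (\<lambda>x. f x * g x)"
  by (simp add: smooth_on_def Ck_on_bounded_bilinear[OF bounded_bilinear_mult])

lemma smooth_on_linear_apply:
  fixes a :: "'u::real_normed_vector \<Rightarrow> 'v::euclidean_space \<Rightarrow> 'w::real_normed_vector"
  assumes "open S" "\<And>y. y \<in> S \<Longrightarrow> linear (a y)" "\<And>v. smooth_on S (\<lambda>y. a y v)" "smooth_on S w"
  shows "smooth_on S (\<lambda>y. a y (w y))"
  using assms Ck_on_linear_apply[of S a _ w] unfolding smooth_on_def by blast

lemma smooth_on_compose: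
  fixes f :: "'u::real_normed_vector \<Rightarrow> 'v::euclidean_space"
  assumes "open S" "f ` S \<subseteq> T" "smooth_on S f" "smooth_on T g"
  shows "smooth_on S (\<lambda>x. g (f x))"
  using assms Ck_on_compose[of S f T _ g] unfolding smooth_on_def by blast

lemma smooth_on_exp:
  fixes f :: "'u::real_normed_vector \<Rightarrow> real"
  assumes "open S" "smooth_on S f"
  shows "smooth_on S (\<lambda>x. exp (f x))"
proof -
  have "Ck_on k S (\<lambda>x. exp (f x))" for k
  proof (induction k)
    case 0
    then show ?case
      using smooth_on_continuous_on[OF assms(2)] by (simp add: continuous_on_exp)
  next
    case (Suc k)
    show ?case
    proof (rule Ck_on_Suc_if_has_derivative[OF assms(1)])
      show "((\<lambda>x. exp (f x)) has_derivative (\<lambda>v. exp (f x) * frechet_derivative f (at x) v)) (at x)"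
        if "x \<in> S" for x
        using smooth_on_has_derivative[OF assms(2) that]
        by (auto intro!: derivative_eq_intros)
      have "Ck_on k S (\<lambda>x. frechet_derivative f (at x) v)" for v
        using smooth_on_deriv[OF assms(2)] unfolding smooth_on_def by blast
      then show "Ck_on k S (\<lambda>x. exp (f x) * frechet_derivative f (at x) v)" for v
        by (intro Ck_on_bounded_bilinear[OF bounded_bilinear_mult assms(1) Suc.IH])
    qed
  qed
  then show ?thesis by (simp add: smooth_on_def)
qed

lemma linear_derivative_of_linear_family:
  assumes "open S" "x \<in> S" "\<And>y. y \<in> S \<Longrightarrow> linear (a y)"
    and D: "\<And>v. ((\<lambda>y. a y v) has_derivative (\<lambda>u. a' u v)) (at x)"
  shows "linear (a' u)"
proof
  fix v1 v2 r
  have "((\<lambda>y. a y (v1 + v2)) has_derivative (\<lambda>u. a' u v1 + a' u v2)) (at x)"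
    by (rule has_derivative_transform_within_open[OF has_derivative_add[OF D D] assms(1,2)])
      (simp add: linear_add[OF assms(3)])
  from has_derivative_unique[OF D this] show "a' u (v1 + v2) = a' u v1 + a' u v2"
    by metis
  have "((\<lambda>y. a y (r *\<^sub>R v1)) has_derivative (\<lambda>u. r *\<^sub>R a' u v1)) (at x)"
    by (rule has_derivative_transform_within_open[OF has_derivative_scaleR_right[OF D] assms(1,2)])
      (simp add: linear_cmul[OF assms(3)])
  from has_derivative_unique[OF D this] show "a' u (r *\<^sub>R v1) = r *\<^sub>R a' u v1"
    by metis
qed

text \<open>After expansion of \<open>w y\<close> in a basis this is the product rule for finitely many scalar multiples.\<close>

lemma has_derivative_linear_apply:
  fixes a :: "'u::real_normed_vector \<Rightarrow> 'v::euclidean_space \<Rightarrow> 'w::real_normed_vector"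
  assumes "open S" "x \<in> S" "\<And>y. y \<in> S \<Longrightarrow> linear (a y)"
    and "\<And>v. ((\<lambda>y. a y v) has_derivative (\<lambda>u. a' u v)) (at x)"
    and "(w has_derivative w') (at x)"
  shows "((\<lambda>y. a y (w y)) has_derivative (\<lambda>u. a' u (w x) + a x (w' u))) (at x)"
proof -
  have a'lin: "linear (a' u)" for u
    by (rule linear_derivative_of_linear_family[OF assms(1,2) _ assms(4)]) (rule assms(3))
  have "((\<lambda>y. \<Sum>b\<in>Basis. (w y \<bullet> b) *\<^sub>R a y b) has_derivative
      (\<lambda>u. \<Sum>b\<in>Basis. (w x \<bullet> b) *\<^sub>R a' u b + (w' u \<bullet> b) *\<^sub>R a x b)) (at x)"
    by (intro has_derivative_sum has_derivative_scaleR has_derivative_inner_left assms(4,5))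
  moreover have "(\<lambda>u. \<Sum>b\<in>Basis. (w x \<bullet> b) *\<^sub>R a' u b + (w' u \<bullet> b) *\<^sub>R a x b) =
      (\<lambda>u. a' u (w x) + a x (w' u))"
    by (simp only: sum.distrib flip: linear_basis_expansion[OF a'lin] linear_basis_expansion[OF assms(3)[OF assms(2)]])
  ultimately have "((\<lambda>y. \<Sum>b\<in>Basis. (w y \<bullet> b) *\<^sub>R a y b) has_derivative
      (\<lambda>u. a' u (w x) + a x (w' u))) (at x)"
    by simp
  then show ?thesis
    by (rule has_derivative_transform_within_open[OF _ assms(1,2)])
      (rule linear_basis_expansion[OF assms(3), symmetric])
qed

section \<open>Symmetry of second derivatives\<close>

text \<open>The mean value theorem in the direction \<open>u\<close>, then in the direction \<open>v\<close>, turns the mixed second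
  difference of \<open>f\<close> into a second derivative at an intermediate point. The left-hand side is symmetric
  in \<open>u\<close> and \<open>v\<close>, whereas the right-hand side differentiates along \<open>u\<close> first.\<close>

lemma mixed_difference_mean_value:
  fixes f :: "'v::real_normed_vector \<Rightarrow> real"
  assumes "0 < s"
    and S: "\<And>a b. a \<in> {0..s} \<Longrightarrow> b \<in> {0..s} \<Longrightarrow> x + a *\<^sub>R u + b *\<^sub>R v \<in> S"
    and f: "\<And>y. y \<in> S \<Longrightarrow> (f has_derivative F y) (at y)"
    and F: "\<And>y. y \<in> S \<Longrightarrow> ((\<lambda>z. F z u) has_derivative G y) (at y)"
  shows "\<exists>a\<in>{0..s}. \<exists>b\<in>{0..s}.
    f (x + s *\<^sub>R u + s *\<^sub>R v) - f (x + s *\<^sub>R u) - f (x + s *\<^sub>R v) + f x =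
      s * s * G (x + a *\<^sub>R u + b *\<^sub>R v) v"
proof -
  have linF: "F y (c *\<^sub>R w) = c * F y w" if "y \<in> S" for y c w
    using linear_cmul[OF has_derivative_linear[OF f[OF that]]] by simp
  have linG: "G y (c *\<^sub>R w) = c * G y w" if "y \<in> S" for y c w
    using linear_cmul[OF has_derivative_linear[OF F[OF that]]] by simp
  let ?\<phi> = "\<lambda>a. f (x + a *\<^sub>R u + s *\<^sub>R v) - f (x + a *\<^sub>R u + 0 *\<^sub>R v)"
  have "(?\<phi> has_derivative (\<lambda>h. F (x + a *\<^sub>R u + s *\<^sub>R v) (h *\<^sub>R u) - F (x + a *\<^sub>R u + 0 *\<^sub>R v) (h *\<^sub>R u)))
      (at a within {0..s})" if "0 \<le> a" "a \<le> s" for a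
  proof (intro has_derivative_diff)
    have "((\<lambda>a. f (x + a *\<^sub>R u + c *\<^sub>R v)) has_derivative
        (\<lambda>h. F (x + a *\<^sub>R u + c *\<^sub>R v) (h *\<^sub>R u))) (at a within {0..s})" if "c \<in> {0..s}" for c
    proof (rule has_derivative_compose[where f = "\<lambda>a. x + a *\<^sub>R u + c *\<^sub>R v" and g = f and f' = "\<lambda>h. h *\<^sub>R u"])
      show "((\<lambda>a. x + a *\<^sub>R u + c *\<^sub>R v) has_derivative (\<lambda>h. h *\<^sub>R u)) (at a within {0..s})"
        by (auto intro!: derivative_eq_intros)
      show "(f has_derivative F (x + a *\<^sub>R u + c *\<^sub>R v)) (at (x + a *\<^sub>R u + c *\<^sub>R v))"
        using f S \<open>0 \<le> a\<close> \<open>a \<le> s\<close> \<open>c \<in> {0..s}\<close> by simp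
    qed
    from this[of s] this[of 0] \<open>0 < s\<close>
    show "((\<lambda>a. f (x + a *\<^sub>R u + s *\<^sub>R v)) has_derivative
        (\<lambda>h. F (x + a *\<^sub>R u + s *\<^sub>R v) (h *\<^sub>R u))) (at a within {0..s})"
      and "((\<lambda>a. f (x + a *\<^sub>R u + 0 *\<^sub>R v)) has_derivative
        (\<lambda>h. F (x + a *\<^sub>R u + 0 *\<^sub>R v) (h *\<^sub>R u))) (at a within {0..s})"
      by auto
  qed
  from mvt_simple[OF \<open>0 < s\<close> this] obtain a where a: "a \<in> {0<..<s}"
    and "?\<phi> s - ?\<phi> 0 = F (x + a *\<^sub>R u + s *\<^sub>R v) ((s - 0) *\<^sub>R u) - F (x + a *\<^sub>R u + 0 *\<^sub>R v) ((s - 0) *\<^sub>R u)"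
    by metis
  then have 1: "?\<phi> s - ?\<phi> 0 = s * (F (x + a *\<^sub>R u + s *\<^sub>R v) u - F (x + a *\<^sub>R u + 0 *\<^sub>R v) u)"
    using linF[OF S[of a s], of s u] linF[OF S[of a 0], of s u] \<open>0 < s\<close>
    by (simp add: right_diff_distrib)
  let ?\<psi> = "\<lambda>b. F (x + a *\<^sub>R u + b *\<^sub>R v) u"
  have "(?\<psi> has_derivative (\<lambda>h. G (x + a *\<^sub>R u + b *\<^sub>R v) (h *\<^sub>R v))) (at b within {0..s})"
    if "0 \<le> b" "b \<le> s" for b
  proof (rule has_derivative_compose[where f = "\<lambda>b. x + a *\<^sub>R u + b *\<^sub>R v" and g = "\<lambda>z. F z u"
        and f' = "\<lambda>h. h *\<^sub>R v"])
    show "((\<lambda>b. x + a *\<^sub>R u + b *\<^sub>R v) has_derivative (\<lambda>h. h *\<^sub>R v)) (at b within {0..s})"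
      by (auto intro!: derivative_eq_intros)
    show "((\<lambda>z. F z u) has_derivative G (x + a *\<^sub>R u + b *\<^sub>R v)) (at (x + a *\<^sub>R u + b *\<^sub>R v))"
      using F S a that by simp
  qed
  from mvt_simple[OF \<open>0 < s\<close> this] obtain b where b: "b \<in> {0<..<s}"
    and "?\<psi> s - ?\<psi> 0 = G (x + a *\<^sub>R u + b *\<^sub>R v) ((s - 0) *\<^sub>R v)"
    by metis
  then have "?\<psi> s - ?\<psi> 0 = s * G (x + a *\<^sub>R u + b *\<^sub>R v) v"
    using linG[OF S[of a b], of s v] a by simp
  with 1 have "?\<phi> s - ?\<phi> 0 = s * s * G (x + a *\<^sub>R u + b *\<^sub>R v) v"
    by simp
  then show ?thesis
    using a b by (intro bexI[of _ a] bexI[of _ b]) (auto simp: algebra_simps)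
qed

text \<open>Both orders of differentiation, each at some point of the same small parallelogram, give the same
  mixed difference divided by \<open>s\<^sup>2\<close>; by continuity they agree in the limit.\<close>

lemma second_derivative_symmetric_real:
  fixes f :: "'v::real_normed_vector \<Rightarrow> real"
  assumes S: "open S" "x \<in> S" and f: "Ck_on 2 S f"
  shows "frechet_derivative (\<lambda>y. frechet_derivative f (at y) u) (at x) v =
    frechet_derivative (\<lambda>y. frechet_derivative f (at y) v) (at x) u"
proof -
  let ?G = "\<lambda>u v y. frechet_derivative (\<lambda>y. frechet_derivative f (at y) u) (at y) v"
  have f2: "Ck_on (Suc (Suc 0)) S f"
    using f by (simp add: numeral_2_eq_2)
  have f1: "(f has_derivative frechet_derivative f (at y)) (at y)" if "y \<in> S" for y
    by (rule Ck_on_Suc_has_derivative[OF f2 that])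
  have F1: "((\<lambda>z. frechet_derivative f (at z) w) has_derivative
      (\<lambda>h. ?G w h y)) (at y)" if "y \<in> S" for y w
    by (rule Ck_on_Suc_has_derivative[OF Ck_on_Suc_deriv[OF f2] that])
  have contG: "(?G w h \<longlongrightarrow> ?G w h x) (nhds x)" for w h
  proof -
    have "continuous_on S (?G w h)"
      using f2 by simp
    then have "isCont (?G w h) x"
      using S by (simp add: continuous_on_eq_continuous_at)
    then show ?thesis
      by (simp only: isCont_def tendsto_at_iff_tendsto_nhds[of "?G w h"])
  qed
  have "\<bar>?G u v x - ?G v u x\<bar> < 2 * e" if "0 < e" for e :: real
  proof -
    have "\<forall>\<^sub>F y in nhds x. y \<in> S \<and> \<bar>?G u v y - ?G u v x\<bar> < e \<and> \<bar>?G v u y - ?G v u x\<bar> < e"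
      using tendstoD[OF contG[of u v] that] tendstoD[OF contG[of v u] that]
        eventually_nhds_in_open[OF S]
      by (intro eventually_conj) (simp_all add: dist_real_def)
    then obtain d where d: "0 < d" and near: "\<And>y. dist y x < d \<Longrightarrow>
        y \<in> S \<and> \<bar>?G u v y - ?G u v x\<bar> < e \<and> \<bar>?G v u y - ?G v u x\<bar> < e"
      unfolding eventually_nhds_metric by blast
    \<comment> \<open>Small enough for the whole parallelogram to lie within \<open>d / 2\<close> of \<open>x\<close>; the summand \<open>1\<close> avoids
      a division by zero for \<open>u = v = 0\<close>.\<close>
    define s where "s = d / (2 * (1 + norm u + norm v))"
    have nn: "0 < 1 + norm u + norm v"
      using norm_ge_zero[of u] norm_ge_zero[of v] by linarith
    then have s: "0 < s"
      using d by (simp add: s_def)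
    have close: "dist (x + a *\<^sub>R p + b *\<^sub>R q) x < d"
      if "a \<in> {0..s}" "b \<in> {0..s}" "norm p + norm q = norm u + norm v" for a b p q
    proof -
      have "dist (x + a *\<^sub>R p + b *\<^sub>R q) x = norm (a *\<^sub>R p + b *\<^sub>R q)"
        by (simp add: dist_norm add.assoc)
      also have "\<dots> \<le> a * norm p + b * norm q"
        using norm_triangle_ineq[of "a *\<^sub>R p" "b *\<^sub>R q"] that by simp
      also have "\<dots> \<le> s * norm p + s * norm q"
        using that by (intro add_mono mult_right_mono) auto
      also have "\<dots> = s * (norm u + norm v)"
        using that(3) by (simp flip: distrib_left)
      also have "\<dots> \<le> s * (1 + norm u + norm v)"
        using s by (intro mult_left_mono) auto
      also have "\<dots> = d / 2"
        using nn unfolding s_def by (simp add: field_simps)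
      also have "\<dots> < d" using d by simp
      finally show ?thesis .
    qed
    have uvS: "x + a *\<^sub>R u + b *\<^sub>R v \<in> S" and vuS: "x + a *\<^sub>R v + b *\<^sub>R u \<in> S"
      if "a \<in> {0..s}" "b \<in> {0..s}" for a b
      using near[OF close[OF that, of u v]] near[OF close[OF that, of v u]] by auto
    obtain a b where ab: "a \<in> {0..s}" "b \<in> {0..s}" and 1:
      "f (x + s *\<^sub>R u + s *\<^sub>R v) - f (x + s *\<^sub>R u) - f (x + s *\<^sub>R v) + f x =
        s * s * ?G u v (x + a *\<^sub>R u + b *\<^sub>R v)"
      using mixed_difference_mean_value[OF s uvS f1 F1] by blast
    obtain a' b' where ab': "a' \<in> {0..s}" "b' \<in> {0..s}" and 2:
      "f (x + s *\<^sub>R v + s *\<^sub>R u) - f (x + s *\<^sub>R v) - f (x + s *\<^sub>R u) + f x =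
        s * s * ?G v u (x + a' *\<^sub>R v + b' *\<^sub>R u)"
      using mixed_difference_mean_value[OF s vuS f1 F1] by blast
    have "x + s *\<^sub>R u + s *\<^sub>R v = x + s *\<^sub>R v + s *\<^sub>R u"
      by (simp add: add_ac)
    with 1 2 have "s * s * ?G u v (x + a *\<^sub>R u + b *\<^sub>R v) = s * s * ?G v u (x + a' *\<^sub>R v + b' *\<^sub>R u)"
      by (simp add: algebra_simps)
    then have "?G u v (x + a *\<^sub>R u + b *\<^sub>R v) = ?G v u (x + a' *\<^sub>R v + b' *\<^sub>R u)"
      using s by simp
    moreover have "\<bar>?G u v (x + a *\<^sub>R u + b *\<^sub>R v) - ?G u v x\<bar> < e"
      using near close[OF ab refl] by blast
    moreover have "\<bar>?G v u (x + a' *\<^sub>R v + b' *\<^sub>R u) - ?G v u x\<bar> < e"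
      using near close[OF ab', of v u] by (simp add: add.commute)
    ultimately show ?thesis by linarith
  qed
  from this[of "\<bar>?G u v x - ?G v u x\<bar> / 2"] show ?thesis
    by (cases "?G u v x = ?G v u x") auto
qed

lemma second_derivative_symmetric:
  fixes f :: "'v::real_normed_vector \<Rightarrow> 'w::euclidean_space"
  assumes S: "open S" "x \<in> S" and f: "Ck_on 2 S f"
  shows "frechet_derivative (\<lambda>y. frechet_derivative f (at y) u) (at x) v =
    frechet_derivative (\<lambda>y. frechet_derivative f (at y) v) (at x) u"
proof (rule euclidean_eqI)
  fix b :: 'w assume "b \<in> Basis"
  have f2: "Ck_on (Suc (Suc 0)) S f"
    using f by (simp add: numeral_2_eq_2)
  have D1: "frechet_derivative (\<lambda>y. f y \<bullet> b) (at y) w = frechet_derivative f (at y) w \<bullet> b"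
    if "y \<in> S" for y w
    using frechet_derivative_at[OF has_derivative_inner_left[OF Ck_on_Suc_has_derivative[OF f2 that]], of b]
    by metis
  have D2: "frechet_derivative (\<lambda>y. frechet_derivative f (at y) w) (at x) h \<bullet> b =
      frechet_derivative (\<lambda>y. frechet_derivative (\<lambda>y. f y \<bullet> b) (at y) w) (at x) h" for w h
  proof -
    have "frechet_derivative (\<lambda>y. frechet_derivative (\<lambda>y. f y \<bullet> b) (at y) w) (at x) =
        frechet_derivative (\<lambda>y. frechet_derivative f (at y) w \<bullet> b) (at x)"
      by (rule frechet_derivative_cong_open[OF S]) (rule D1)
    also have "\<dots> = (\<lambda>h. frechet_derivative (\<lambda>y. frechet_derivative f (at y) w) (at x) h \<bullet> b)"
      by (rule frechet_derivative_at[symmetric], rule has_derivative_inner_left,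
          rule Ck_on_Suc_has_derivative[OF Ck_on_Suc_deriv[OF f2] S(2)])
    finally show ?thesis by simp
  qed
  have "Ck_on 2 S (\<lambda>y. f y \<bullet> b)"
    by (rule Ck_on_bounded_linear[OF bounded_linear_inner_left S(1) f])
  from second_derivative_symmetric_real[OF S this, of u v]
  show "frechet_derivative (\<lambda>y. frechet_derivative f (at y) u) (at x) v \<bullet> b =
    frechet_derivative (\<lambda>y. frechet_derivative f (at y) v) (at x) u \<bullet> b"
    by (simp only: D2)
qed

section \<open>The Poincare lemma for one-forms\<close>

text \<open>The potential is the line integral of \<open>a\<close> along the segment from a base point \<open>x0\<close>. Differentiating
  under the integral sign gives the integrand \<open>t Da(\<gamma>)(u)(y - x0) + a(\<gamma>)(u)\<close>; closedness exchanges \<open>u\<close>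
  and \<open>y - x0\<close> in the first term, after which the integrand is the \<open>t\<close>-derivative of \<open>t a(\<gamma>)(u)\<close>.\<close>

lemma poincare_one_form_convex:
  fixes a :: "'v::euclidean_space \<Rightarrow> 'v \<Rightarrow> real"
  assumes S: "open S" "convex S"
    and lin: "\<And>y. y \<in> S \<Longrightarrow> linear (a y)"
    and smooth: "\<And>v. smooth_on S (\<lambda>y. a y v)"
    and closed: "\<And>y u v. y \<in> S \<Longrightarrow>
      frechet_derivative (\<lambda>z. a z v) (at y) u = frechet_derivative (\<lambda>z. a z u) (at y) v"
  shows "\<exists>F. smooth_on S F \<and> (\<forall>y\<in>S. (F has_derivative a y) (at y))"
proof (cases "S = {}")
  case True
  then show ?thesis
    by (intro exI[of _ "\<lambda>x. 0"]) (simp add: smooth_on_const)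
next
  case False
  then obtain x0 where x0: "x0 \<in> S" by blast
  define \<gamma> where "\<gamma> y t = x0 + t *\<^sub>R (y - x0)" for y t
  define da where "da y u v = frechet_derivative (\<lambda>z. a z v) (at y) u" for y u v
  have \<gamma>: "\<gamma> y t \<in> S" if "y \<in> S" "t \<in> cbox 0 1" for y t
  proof -
    have "\<gamma> y t = (1 - t) *\<^sub>R x0 + t *\<^sub>R y"
      by (simp add: \<gamma>_def algebra_simps)
    then show ?thesis
      using convexD_alt[OF S(2) x0 that(1), of t] that(2) by auto
  qed
  have da: "((\<lambda>z. a z v) has_derivative (\<lambda>u. da y u v)) (at y)" if "y \<in> S" for y v
    unfolding da_def by (rule smooth_on_has_derivative[OF smooth that])
  have da_lin: "linear (\<lambda>u. da y u v)" if "y \<in> S" for y v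
    by (rule has_derivative_linear[OF da[OF that]])
  have da_sym: "da y u v = da y v u" if "y \<in> S" for y u v
    unfolding da_def by (rule closed[OF that])
  define c where "c y t b = t * da (\<gamma> y t) (y - x0) b + a (\<gamma> y t) b" for y t b
  \<comment> \<open>The derivative of the integrand as a bounded linear function. In its coefficients
    \<open>c\<close> the arguments of \<open>da\<close> are already exchanged by closedness: \<open>da (\<gamma> y t) (y - x0)\<close> differentiates
    along the segment, as the fundamental theorem of calculus requires.\<close>
  define fx where "fx y t = (\<Sum>b\<in>Basis. c y t b *\<^sub>R blinfun_inner_right b)" for y t
  have fx: "blinfun_apply (fx y t) u = t * da (\<gamma> y t) (y - x0) u + a (\<gamma> y t) u"
    if "y \<in> S" "t \<in> cbox 0 1" for y t u
  proof -
    have "linear (\<lambda>b. da (\<gamma> y t) (y - x0) b)"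
      unfolding da_sym[OF \<gamma>[OF that], of "y - x0"] by (rule da_lin[OF \<gamma>[OF that]])
    note expand = linear_basis_expansion[OF this, of u] linear_basis_expansion[OF lin[OF \<gamma>[OF that]], of u]
    have "blinfun_apply (fx y t) u = (\<Sum>b\<in>Basis. c y t b * (b \<bullet> u))"
      by (simp add: fx_def blinfun.sum_left blinfun.scaleR_left)
    also have "\<dots> = t * (\<Sum>b\<in>Basis. (u \<bullet> b) *\<^sub>R da (\<gamma> y t) (y - x0) b) +
        (\<Sum>b\<in>Basis. (u \<bullet> b) *\<^sub>R a (\<gamma> y t) b)"
      by (simp add: c_def sum.distrib sum_distrib_left algebra_simps inner_commute)
    finally show ?thesis
      by (simp only: expand)
  qed
  have cont_\<gamma>: "continuous_on (S \<times> cbox 0 1) (\<lambda>p. h (\<gamma> (fst p) (snd p)))"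
    if "continuous_on S h" for h :: "'v \<Rightarrow> real"
  proof (rule continuous_on_compose2[OF that])
    show "continuous_on (S \<times> cbox 0 1) (\<lambda>p. \<gamma> (fst p) (snd p))"
      unfolding \<gamma>_def by (intro continuous_intros)
  qed (use \<gamma> in auto)
  have cont_c: "continuous_on (S \<times> cbox 0 1) (\<lambda>p. c (fst p) (snd p) b)" for b
  proof -
    have "continuous_on (S \<times> cbox 0 1) (\<lambda>p. snd p *
        (\<Sum>e\<in>Basis. ((fst p - x0) \<bullet> e) * da (\<gamma> (fst p) (snd p)) e b) + a (\<gamma> (fst p) (snd p)) b)"
      by (intro continuous_intros cont_\<gamma> smooth_on_continuous_on smooth)
        (simp add: da_def smooth_on_deriv[OF smooth])
    moreover have "(\<Sum>e\<in>Basis. ((fst p - x0) \<bullet> e) * da (\<gamma> (fst p) (snd p)) e b) =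
        da (\<gamma> (fst p) (snd p)) (fst p - x0) b" if "p \<in> S \<times> cbox 0 1" for p
      using linear_basis_expansion[OF da_lin[OF \<gamma>, of "fst p" "snd p" b], of "fst p - x0"] that
      by auto
    ultimately show ?thesis
      unfolding c_def by (simp cong: continuous_on_cong)
  qed
  have cont_fx: "continuous_on (S \<times> cbox 0 1) (\<lambda>(y, t). fx y t)"
    unfolding fx_def split_beta by (intro continuous_intros cont_c)
  define F where "F y = integral (cbox 0 1) (\<lambda>t. a (\<gamma> y t) (y - x0))" for y
  have F: "(F has_derivative a y) (at y)" if y: "y \<in> S" for y
  proof -
    have "((\<lambda>z. a (\<gamma> z t) (z - x0)) has_derivative blinfun_apply (fx z t)) (at z within S)"
      if z: "z \<in> S" and t: "t \<in> cbox 0 1" for z t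
    proof -
      have lin_\<gamma>: "linear (a (\<gamma> y t))" if "y \<in> S" for y
        by (rule lin[OF \<gamma>[OF that t]])
      have coeff: "((\<lambda>z. a (\<gamma> z t) v) has_derivative (\<lambda>u. da (\<gamma> z t) (t *\<^sub>R u) v)) (at z)" for v
      proof (rule has_derivative_compose[where f = "\<lambda>z. \<gamma> z t" and g = "\<lambda>y. a y v"
            and f' = "\<lambda>u. t *\<^sub>R u"])
        show "((\<lambda>z. \<gamma> z t) has_derivative (\<lambda>u. t *\<^sub>R u)) (at z)"
          unfolding \<gamma>_def by (auto intro!: derivative_eq_intros)
      qed (rule da[OF \<gamma>[OF z t]])
      have arg: "((\<lambda>z. z - x0) has_derivative (\<lambda>u. u)) (at z)"
        by (auto intro!: derivative_eq_intros)
      have "((\<lambda>z. a (\<gamma> z t) (z - x0)) has_derivative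
          (\<lambda>u. da (\<gamma> z t) (t *\<^sub>R u) (z - x0) + a (\<gamma> z t) u)) (at z)"
        by (rule has_derivative_linear_apply[OF S(1) z _ coeff arg]) (rule lin_\<gamma>)
      moreover have "da (\<gamma> z t) (t *\<^sub>R u) (z - x0) + a (\<gamma> z t) u = blinfun_apply (fx z t) u" for u
        using fx[OF z t] linear_cmul[OF da_lin[OF \<gamma>[OF z t]]] da_sym[OF \<gamma>[OF z t], of u "z - x0"]
        by simp
      ultimately show ?thesis
        by (simp add: has_derivative_at_withinI)
    qed
    moreover have "(\<lambda>t. a (\<gamma> z t) (z - x0)) integrable_on cbox 0 1" if z: "z \<in> S" for z
    proof (rule integrable_continuous)
      have "continuous_on (cbox 0 1) (\<lambda>t. a (\<gamma> z t) b)" for b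
        by (rule continuous_on_compose2[OF cont_\<gamma>[OF smooth_on_continuous_on[OF smooth]],
              of _ "\<lambda>t. (z, t)", unfolded fst_conv snd_conv])
          (auto intro!: continuous_intros z)
      then have "continuous_on (cbox 0 1) (\<lambda>t. \<Sum>b\<in>Basis. ((z - x0) \<bullet> b) *\<^sub>R a (\<gamma> z t) b)"
        by (intro continuous_intros)
      then show "continuous_on (cbox 0 1) (\<lambda>t. a (\<gamma> z t) (z - x0))"
        by (rule continuous_on_eq) (rule linear_basis_expansion[OF lin[OF \<gamma>[OF z]], symmetric])
    qed
    ultimately have "(F has_derivative integral (cbox 0 1) (fx y)) (at y within S)"
      unfolding F_def by (rule leibniz_rule[OF _ _ cont_fx y S(2)])
    moreover have "blinfun_apply (integral (cbox 0 1) (fx y)) u = a y u" for u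
    proof -
      have "continuous_on (cbox 0 1) (fx y)"
        by (rule continuous_on_compose2[OF cont_fx, of _ "\<lambda>t. (y, t)", unfolded split_beta fst_conv snd_conv])
          (auto intro!: continuous_intros y)
      then have "blinfun_apply (integral (cbox 0 1) (fx y)) u =
          integral (cbox 0 1) (\<lambda>t. blinfun_apply (fx y t) u)"
        using integral_linear[OF integrable_continuous, of 0 1 "fx y" "\<lambda>B. blinfun_apply B u"]
        by (simp add: o_def blinfun.bounded_linear_left)
      also have "\<dots> = integral (cbox 0 1) (\<lambda>t. t * da (\<gamma> y t) (y - x0) u + a (\<gamma> y t) u)"
        by (rule integral_cong) (rule fx[OF y])
      also have "\<dots> = 1 * a (\<gamma> y 1) u - 0 * a (\<gamma> y 0) u"
      proof (rule integral_unique, unfold cbox_interval,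
          rule fundamental_theorem_of_calculus[where f = "\<lambda>t. t * a (\<gamma> y t) u"])
        fix t :: real assume t: "t \<in> {0..1}"
        have "((\<lambda>t. a (\<gamma> y t) u) has_derivative (\<lambda>h. da (\<gamma> y t) (h *\<^sub>R (y - x0)) u)) (at t)"
        proof (rule has_derivative_compose[where f = "\<lambda>t. \<gamma> y t" and g = "\<lambda>y. a y u"
              and f' = "\<lambda>h. h *\<^sub>R (y - x0)"])
          show "((\<lambda>t. \<gamma> y t) has_derivative (\<lambda>h. h *\<^sub>R (y - x0))) (at t)"
            unfolding \<gamma>_def by (auto intro!: derivative_eq_intros)
        qed (use da \<gamma> y t in auto)
        then have "((\<lambda>t. a (\<gamma> y t) u) has_vector_derivative da (\<gamma> y t) (y - x0) u) (at t)"
          using linear_cmul[OF da_lin[OF \<gamma>[OF y, of t]]] t by (simp add: has_vector_derivative_def)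
        then have "((\<lambda>t. t * a (\<gamma> y t) u) has_vector_derivative
            t * da (\<gamma> y t) (y - x0) u + 1 * a (\<gamma> y t) u) (at t)"
          by (intro has_vector_derivative_mult has_vector_derivative_id)
        then show "((\<lambda>t. t * a (\<gamma> y t) u) has_vector_derivative
            t * da (\<gamma> y t) (y - x0) u + a (\<gamma> y t) u) (at t within {0..1})"
          by (simp add: has_vector_derivative_at_within)
      qed simp
      also have "\<dots> = a y u" by (simp add: \<gamma>_def)
      finally show ?thesis .
    qed
    then have "blinfun_apply (integral (cbox 0 1) (fx y)) = a y"
      by (rule ext)
    ultimately show ?thesis
      unfolding at_within_open[OF y S(1)] by simp
  qed
  then have "smooth_on S F"
    by (intro smooth_on_if_has_derivative[OF S(1) _ smooth])
  with F show ?thesis by blast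
qed

section \<open>Differential forms on open subsets of a vector space\<close>

definition local_form_on :: "'v::real_normed_vector set \<Rightarrow> nat \<Rightarrow> ('v \<Rightarrow> 'v list \<Rightarrow> real) \<Rightarrow> bool" where
  "local_form_on S k \<phi> \<longleftrightarrow>
     (\<forall>x\<in>S. multilinear_form k (\<phi> x) \<and> alternating_form k (\<phi> x)) \<and>
     (\<forall>as. length as = k \<longrightarrow> smooth_on S (\<lambda>x. \<phi> x as))"

definition local_ext_deriv ::
    "('v::real_normed_vector \<Rightarrow> 'v list \<Rightarrow> real) \<Rightarrow> 'v \<Rightarrow> 'v list \<Rightarrow> real" where
  "local_ext_deriv \<phi> x vs =
     (\<Sum>i<length vs. (-1) ^ i * frechet_derivative (\<lambda>y. \<phi> y (omit i vs)) (at x) (vs ! i))"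

lemma length_omit: "i < length xs \<Longrightarrow> length (omit i xs) = length xs - 1"
  by (simp add: omit_def)

lemma map_omit: "map f (omit i xs) = omit i (map f xs)"
  by (simp add: omit_def take_map drop_map)

lemma set_omit: "set (omit i xs) \<subseteq> set xs"
  unfolding omit_def using set_take_subset set_drop_subset by fastforce

text \<open>Lists split at a slot are easier to compute with than list updates.\<close>

lemma multilinear_form_slot:
  assumes "multilinear_form k \<phi>" "length as + Suc (length bs) = k"
  shows "linear (\<lambda>a. \<phi> (as @ a # bs))"
proof -
  have "linear (\<lambda>a. \<phi> ((as @ undefined # bs)[length as := a]))"
    using assms(2)
    by (intro assms(1)[unfolded multilinear_form_def, rule_format]) simp
  then show ?thesis by simp
qed

lemma multilinear_formI:
  assumes "\<And>as bs. length as + Suc (length bs) = k \<Longrightarrow> linear (\<lambda>a. \<phi> (as @ a # bs))"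
  shows "multilinear_form k \<phi>"
  unfolding multilinear_form_def
proof (intro allI impI)
  fix as :: "'a list" and i assume "length as = k \<and> i < k"
  then show "linear (\<lambda>a. \<phi> (as[i := a]))"
    using assms[of "take i as" "drop (Suc i) as"] by (simp add: upd_conv_take_nth_drop)
qed

lemma local_form_on_subset:
  "local_form_on S k \<phi> \<Longrightarrow> T \<subseteq> S \<Longrightarrow> local_form_on T k \<phi>"
  unfolding local_form_on_def using smooth_on_subset by blast

lemma local_form_on_cong:
  assumes "open S" "\<And>x as. x \<in> S \<Longrightarrow> length as = k \<Longrightarrow> \<phi> x as = \<psi> x as" "local_form_on S k \<phi>"
  shows "local_form_on S k \<psi>"
  unfolding local_form_on_def
proof (intro conjI ballI allI impI)
  fix x assume x: "x \<in> S"
  with assms(3) have "multilinear_form k (\<phi> x)" and alt: "alternating_form k (\<phi> x)"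
    by (auto simp: local_form_on_def)
  then show "multilinear_form k (\<psi> x)"
    unfolding multilinear_form_def by (simp add: assms(2)[OF x, symmetric])
  show "alternating_form k (\<psi> x)"
    using alt unfolding alternating_form_def by (simp add: assms(2)[OF x, symmetric])
next
  fix as :: "'a list" assume "length as = k"
  with assms(3) show "smooth_on S (\<lambda>x. \<psi> x as)"
    using smooth_on_cong[OF assms(1), of "\<lambda>x. \<phi> x as" "\<lambda>x. \<psi> x as"] assms(2)
    unfolding local_form_on_def by blast
qed

lemma local_form_on_scale:
  assumes "open S" "smooth_on S h" "local_form_on S k \<phi>"
  shows "local_form_on S k (\<lambda>x as. h x * \<phi> x as)"
  using assms unfolding local_form_on_def multilinear_form_def alternating_form_def
  by (auto intro!: smooth_on_mult linear_compose_scale_right[where 'b = real, unfolded real_scaleR_def])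

text \<open>Smoothness is obtained by replacing the constant arguments by \<open>J x v\<close> one slot at a time, from the
  left; each replacement is an instance of \<open>smooth_on_linear_apply\<close>.\<close>

lemma local_form_on_map_endomorphism:
  fixes J :: "'v::euclidean_space \<Rightarrow> 'v \<Rightarrow> 'v"
  assumes S: "open S" and \<phi>: "local_form_on S k \<phi>"
    and J: "\<And>x. x \<in> S \<Longrightarrow> linear (J x)" "\<And>v. smooth_on S (\<lambda>x. J x v)"
  shows "local_form_on S k (\<lambda>x vs. \<phi> x (map (J x) vs))"
  unfolding local_form_on_def
proof (intro conjI ballI allI impI)
  fix x assume x: "x \<in> S"
  then have ml: "multilinear_form k (\<phi> x)" and alt: "alternating_form k (\<phi> x)"
    using \<phi> by (auto simp: local_form_on_def)
  show "multilinear_form k (\<lambda>vs. \<phi> x (map (J x) vs))"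
  proof (rule multilinear_formI)
    fix as bs :: "'v list" assume "length as + Suc (length bs) = k"
    then show "linear (\<lambda>a. \<phi> x (map (J x) (as @ a # bs)))"
      using linear_compose[OF J(1)[OF x] multilinear_form_slot[OF ml, of "map (J x) as" "map (J x) bs"]]
      by (simp add: o_def)
  qed
  show "alternating_form k (\<lambda>vs. \<phi> x (map (J x) vs))"
    unfolding alternating_form_def
  proof (intro allI impI)
    fix vs :: "'v list" and i j :: nat
    assume "length vs = k \<and> i < j \<and> j < k \<and> vs ! i = vs ! j"
    then show "\<phi> x (map (J x) vs) = 0"
      by (intro alt[unfolded alternating_form_def, rule_format, of _ i j]) auto
  qed
next
  fix vs :: "'v list" assume "length vs = k"
  moreover have "smooth_on S (\<lambda>x. \<phi> x (map (J x) as @ bs))" if "length as + length bs = k" for as bs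
    using that
  proof (induction as arbitrary: bs rule: rev_induct)
    case Nil
    then show ?case using \<phi> by (simp add: local_form_on_def)
  next
    case (snoc v as)
    have "smooth_on S (\<lambda>x. \<phi> x (map (J x) as @ J x v # bs))"
    proof (rule smooth_on_linear_apply[OF S _ _ J(2)])
      show "linear (\<lambda>e. \<phi> x (map (J x) as @ e # bs))" if "x \<in> S" for x
        using that \<phi> snoc.prems
        by (intro multilinear_form_slot[of k]) (auto simp: local_form_on_def)
      show "smooth_on S (\<lambda>x. \<phi> x (map (J x) as @ e # bs))" for e
        using snoc.prems by (intro snoc.IH) simp
    qed
    then show ?case by simp
  qed
  from this[of vs "[]"] show "smooth_on S (\<lambda>x. \<phi> x (map (J x) vs))"
    using \<open>length vs = k\<close> by simp
qed

lemma local_form_on_linear1: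
  "local_form_on S 1 \<phi> \<Longrightarrow> x \<in> S \<Longrightarrow> linear (\<lambda>a. \<phi> x [a])"
  using multilinear_form_slot[of 1 "\<phi> x" "[]" "[]"] by (simp add: local_form_on_def)

lemma local_form_on_linear2:
  assumes "local_form_on S 2 \<phi>" "x \<in> S"
  shows "linear (\<lambda>a. \<phi> x [a, b])" "linear (\<lambda>a. \<phi> x [b, a])"
  using assms multilinear_form_slot[of 2 "\<phi> x" "[]" "[b]"] multilinear_form_slot[of 2 "\<phi> x" "[b]" "[]"]
  by (simp_all add: local_form_on_def)

lemma local_form_on_swap:
  assumes "local_form_on S 2 \<phi>" "x \<in> S"
  shows "\<phi> x [b, a] = - \<phi> x [a, b]"
proof -
  have diag: "\<phi> x [a, a] = 0" for a
  proof -
    have "length [a, a] = 2 \<and> (0::nat) < 1 \<and> (1::nat) < 2 \<and> [a, a] ! 0 = [a, a] ! 1 \<longrightarrow> \<phi> x [a, a] = 0"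
      using assms unfolding local_form_on_def alternating_form_def by blast
    then show ?thesis by simp
  qed
  have "\<phi> x [a + b, a + b] = \<phi> x [a, a] + \<phi> x [a, b] + \<phi> x [b, a] + \<phi> x [b, b]"
    using linear_add[OF local_form_on_linear2(1)[OF assms]] linear_add[OF local_form_on_linear2(2)[OF assms]]
    by simp
  then show ?thesis by (simp add: diag)
qed

lemma local_form_on_has_derivative:
  assumes "local_form_on S k \<phi>" "x \<in> S" "length as = k"
  shows "((\<lambda>y. \<phi> y as) has_derivative frechet_derivative (\<lambda>y. \<phi> y as) (at x)) (at x)"
  using assms smooth_on_has_derivative unfolding local_form_on_def by blast

lemma local_ext_deriv_pair:
  "local_ext_deriv \<phi> x [u, v] =
    frechet_derivative (\<lambda>y. \<phi> y [v]) (at x) u - frechet_derivative (\<lambda>y. \<phi> y [u]) (at x) v"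
  by (simp add: local_ext_deriv_def omit_def)

lemma local_ext_deriv_triple:
  "local_ext_deriv \<phi> x [u, v, w] =
    frechet_derivative (\<lambda>y. \<phi> y [v, w]) (at x) u - frechet_derivative (\<lambda>y. \<phi> y [u, w]) (at x) v +
    frechet_derivative (\<lambda>y. \<phi> y [u, v]) (at x) w"
  by (simp add: local_ext_deriv_def omit_def numeral_2_eq_2)

text \<open>The derivative of a family of alternating bilinear maps is again alternating and bilinear. On
  vectors two of which agree, one of the three terms of the exterior derivative therefore vanishes and the
  other two cancel.\<close>

lemma local_form_on_ext_deriv:
  fixes \<phi> :: "'v::euclidean_space \<Rightarrow> 'v list \<Rightarrow> real"
  assumes S: "open S" and \<phi>: "local_form_on S 2 \<phi>"
  shows "local_form_on S 3 (local_ext_deriv \<phi>)"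
  unfolding local_form_on_def
proof (intro conjI ballI allI impI)
  let ?D = "\<lambda>x v w u. frechet_derivative (\<lambda>y. \<phi> y [v, w]) (at x) u"
  have list3: "\<exists>a b c. vs = [a, b, c]" if "length vs = 3" for vs :: "'v list"
    using that by (auto simp: numeral_3_eq_3 length_Suc_conv)
  { fix x assume x: "x \<in> S"
    have diff: "(\<lambda>y. \<phi> y [v, w]) differentiable (at x)" for v w
      using local_form_on_has_derivative[OF \<phi> x, of "[v, w]"] by (auto intro: differentiableI)
    have D: "((\<lambda>y. \<phi> y [v, w]) has_derivative (\<lambda>u. ?D x v w u)) (at x)" for v w
      using diff unfolding frechet_derivative_works .
    have lin: "linear (\<lambda>u. ?D x v w u)" "linear (\<lambda>u. ?D x v u w)" "linear (\<lambda>u. ?D x u v w)" for v w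
    proof -
      show "linear (\<lambda>u. ?D x v w u)"
        by (rule has_derivative_linear[OF D])
      show "linear (\<lambda>u. ?D x v u w)"
        by (rule linear_derivative_of_linear_family[OF S x local_form_on_linear2(2)[OF \<phi>] D])
      show "linear (\<lambda>u. ?D x u v w)"
        by (rule linear_derivative_of_linear_family[OF S x local_form_on_linear2(1)[OF \<phi>] D])
    qed
    have swap: "?D x v w u = - ?D x w v u" for u v w
    proof -
      have "frechet_derivative (\<lambda>y. \<phi> y [v, w]) (at x) = frechet_derivative (\<lambda>y. - \<phi> y [w, v]) (at x)"
        by (rule frechet_derivative_cong_open[OF S x]) (rule local_form_on_swap[OF \<phi>])
      then show ?thesis
        using frechet_derivative_at[OF has_derivative_minus[OF diff[unfolded frechet_derivative_works]], of w v]
        by metis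
    qed
    have diag: "?D x v v u = 0" for u v
      using swap[of v v u] by simp
    show "multilinear_form 3 (local_ext_deriv \<phi> x)"
    proof (rule multilinear_formI)
      fix as bs :: "'v list" assume "length as + Suc (length bs) = 3"
      then consider b c where "as = []" "bs = [b, c]" | b c where "as = [b]" "bs = [c]"
        | b c where "as = [b, c]" "bs = []"
        by (cases as; cases bs; cases "tl as"; cases "tl bs") auto
      then show "linear (\<lambda>a. local_ext_deriv \<phi> x (as @ a # bs))"
        by cases (simp_all add: local_ext_deriv_triple lin linear_compose_add linear_compose_sub)
    qed
    show "alternating_form 3 (local_ext_deriv \<phi> x)"
      unfolding alternating_form_def
    proof (intro allI impI)
      fix as :: "'v list" and i j :: nat
      assume *: "length as = 3 \<and> i < j \<and> j < 3 \<and> as ! i = as ! j"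
      then obtain a b c where as: "as = [a, b, c]" using list3 by blast
      from * consider "i = 0" "j = 1" | "i = 0" "j = 2" | "i = 1" "j = 2"
        by linarith
      then show "local_ext_deriv \<phi> x as = 0"
      proof cases
        case 1
        with * as have "a = b" by simp
        then show ?thesis by (simp add: as local_ext_deriv_triple diag)
      next
        case 2
        with * as have "a = c" by simp
        then show ?thesis using swap[of a b c] by (simp add: as local_ext_deriv_triple diag)
      next
        case 3
        with * as have "b = c" by (simp add: numeral_2_eq_2)
        then show ?thesis by (simp add: as local_ext_deriv_triple diag)
      qed
    qed }
  fix vs :: "'v list" assume "length vs = 3"
  then obtain a b c where vs: "vs = [a, b, c]" using list3 by blast
  have "smooth_on S (\<lambda>x. ?D x v w u)" for v w u
    using \<phi> by (intro smooth_on_deriv) (simp add: local_form_on_def)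
  then have "smooth_on S (\<lambda>x. ?D x b c a + - ?D x a c b + ?D x a b c)"
    by (intro smooth_on_add smooth_on_minus S)
  then show "smooth_on S (\<lambda>x. local_ext_deriv \<phi> x vs)"
    by (simp add: vs local_ext_deriv_triple)
qed

text \<open>Besides the pullback of \<open>d\<psi>\<close> there are the two terms \<open>\<psi>(D\<^sup>2\<tau>(u, v))\<close> and \<open>- \<psi>(D\<^sup>2\<tau>(v, u))\<close>,
  which cancel because second derivatives are symmetric.\<close>

lemma local_ext_deriv_pullback_1:
  fixes \<tau> :: "'v::euclidean_space \<Rightarrow> 'w::euclidean_space"
  assumes S: "open S" "x \<in> S" and \<tau>: "smooth_on S \<tau>" "\<tau> ` S \<subseteq> T"
    and \<psi>: "local_form_on T 1 \<psi>"
    and \<phi>: "\<And>y vs. y \<in> S \<Longrightarrow> \<phi> y vs = \<psi> (\<tau> y) (map (frechet_derivative \<tau> (at y)) vs)"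
  shows "local_ext_deriv \<phi> x [u, v] = local_ext_deriv \<psi> (\<tau> x) (map (frechet_derivative \<tau> (at x)) [u, v])"
proof -
  let ?d = "\<lambda>y. frechet_derivative \<tau> (at y)"
  let ?dd = "\<lambda>v. frechet_derivative (\<lambda>y. ?d y v) (at x)"
  have T: "\<tau> y \<in> T" if "y \<in> S" for y using that \<tau>(2) by blast
  have "((\<lambda>y. \<phi> y [v]) has_derivative
      (\<lambda>u. frechet_derivative (\<lambda>z. \<psi> z [?d x v]) (at (\<tau> x)) (?d x u) + \<psi> (\<tau> x) [?dd v u])) (at x)" for v
  proof -
    have "((\<lambda>y. \<psi> (\<tau> y) [?d y v]) has_derivative
        (\<lambda>u. frechet_derivative (\<lambda>z. \<psi> z [?d x v]) (at (\<tau> x)) (?d x u) + \<psi> (\<tau> x) [?dd v u])) (at x)"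
    proof (rule has_derivative_linear_apply[OF S, where a = "\<lambda>y w. \<psi> (\<tau> y) [w]" and w = "\<lambda>y. ?d y v"])
      show "linear (\<lambda>w. \<psi> (\<tau> y) [w])" if "y \<in> S" for y
        by (rule local_form_on_linear1[OF \<psi> T[OF that]])
      show "((\<lambda>y. \<psi> (\<tau> y) [e]) has_derivative
          (\<lambda>u. frechet_derivative (\<lambda>z. \<psi> z [e]) (at (\<tau> x)) (?d x u))) (at x)" for e
        by (rule has_derivative_compose[OF smooth_on_has_derivative[OF \<tau>(1) S(2)]
              local_form_on_has_derivative[OF \<psi> T[OF S(2)]]]) simp
      show "((\<lambda>y. ?d y v) has_derivative ?dd v) (at x)"
        by (rule smooth_on_has_derivative[OF smooth_on_deriv[OF \<tau>(1)] S(2)])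
    qed
    then show ?thesis
      by (rule has_derivative_transform_within_open[OF _ S]) (simp add: \<phi>)
  qed
  from frechet_derivative_at[OF this, symmetric]
  have D: "frechet_derivative (\<lambda>y. \<phi> y [v]) (at x) u =
      frechet_derivative (\<lambda>z. \<psi> z [?d x v]) (at (\<tau> x)) (?d x u) + \<psi> (\<tau> x) [?dd v u]" for u v
    by (rule fun_cong)
  have "?dd u v = ?dd v u"
    using \<tau>(1) by (intro second_derivative_symmetric[OF S]) (simp add: smooth_on_def)
  then show ?thesis
    by (simp add: local_ext_deriv_pair D)
qed

text \<open>Each of the three pairs of vectors contributes two terms with a second derivative of \<open>\<tau>\<close>. For
  \<open>u, v\<close> and for \<open>v, w\<close> they cancel by symmetry alone; for \<open>u, w\<close> the second derivative sits in
  the second slot of \<open>\<psi>\<close> in one term and in the first slot in the other, and antisymmetry of \<open>\<psi>\<close>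
  completes the cancellation.\<close>

lemma local_ext_deriv_pullback_2:
  fixes \<tau> :: "'v::euclidean_space \<Rightarrow> 'w::euclidean_space"
  assumes S: "open S" "x \<in> S" and \<tau>: "smooth_on S \<tau>" "\<tau> ` S \<subseteq> T"
    and \<psi>: "local_form_on T 2 \<psi>"
    and \<phi>: "\<And>y vs. y \<in> S \<Longrightarrow> \<phi> y vs = \<psi> (\<tau> y) (map (frechet_derivative \<tau> (at y)) vs)"
  shows "local_ext_deriv \<phi> x [u, v, w] =
    local_ext_deriv \<psi> (\<tau> x) (map (frechet_derivative \<tau> (at x)) [u, v, w])"
proof -
  let ?d = "\<lambda>y. frechet_derivative \<tau> (at y)"
  let ?dd = "\<lambda>v. frechet_derivative (\<lambda>y. ?d y v) (at x)"
  have T: "\<tau> y \<in> T" if "y \<in> S" for y using that \<tau>(2) by blast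
  have dd: "((\<lambda>y. ?d y v) has_derivative ?dd v) (at x)" for v
    by (rule smooth_on_has_derivative[OF smooth_on_deriv[OF \<tau>(1)] S(2)])
  have "((\<lambda>y. \<phi> y [v, w]) has_derivative
      (\<lambda>u. frechet_derivative (\<lambda>z. \<psi> z [?d x v, ?d x w]) (at (\<tau> x)) (?d x u) +
        \<psi> (\<tau> x) [?dd v u, ?d x w] + \<psi> (\<tau> x) [?d x v, ?dd w u])) (at x)" for v w
  proof -
    have one: "((\<lambda>y. \<psi> (\<tau> y) [?d y v, e]) has_derivative
        (\<lambda>u. frechet_derivative (\<lambda>z. \<psi> z [?d x v, e]) (at (\<tau> x)) (?d x u) +
          \<psi> (\<tau> x) [?dd v u, e])) (at x)" for e
    proof (rule has_derivative_linear_apply[OF S, where a = "\<lambda>y w. \<psi> (\<tau> y) [w, e]" and w = "\<lambda>y. ?d y v"])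
      show "linear (\<lambda>w. \<psi> (\<tau> y) [w, e])" if "y \<in> S" for y
        by (rule local_form_on_linear2[OF \<psi> T[OF that]])
      show "((\<lambda>y. \<psi> (\<tau> y) [w, e]) has_derivative
          (\<lambda>u. frechet_derivative (\<lambda>z. \<psi> z [w, e]) (at (\<tau> x)) (?d x u))) (at x)" for w
        by (rule has_derivative_compose[OF smooth_on_has_derivative[OF \<tau>(1) S(2)]
              local_form_on_has_derivative[OF \<psi> T[OF S(2)]]]) simp
    qed (rule dd)
    have "((\<lambda>y. \<psi> (\<tau> y) [?d y v, ?d y w]) has_derivative
      (\<lambda>u. frechet_derivative (\<lambda>z. \<psi> z [?d x v, ?d x w]) (at (\<tau> x)) (?d x u) +
        \<psi> (\<tau> x) [?dd v u, ?d x w] + \<psi> (\<tau> x) [?d x v, ?dd w u])) (at x)"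
    proof (rule has_derivative_linear_apply[OF S, where a = "\<lambda>y e. \<psi> (\<tau> y) [?d y v, e]" and w = "\<lambda>y. ?d y w"])
      show "linear (\<lambda>e. \<psi> (\<tau> y) [?d y v, e])" if "y \<in> S" for y
        by (rule local_form_on_linear2[OF \<psi> T[OF that]])
    qed (rule one dd)+
    then show ?thesis
      by (rule has_derivative_transform_within_open[OF _ S]) (simp add: \<phi>)
  qed
  from frechet_derivative_at[OF this, symmetric]
  have D: "frechet_derivative (\<lambda>y. \<phi> y [v, w]) (at x) u =
      frechet_derivative (\<lambda>z. \<psi> z [?d x v, ?d x w]) (at (\<tau> x)) (?d x u) +
        \<psi> (\<tau> x) [?dd v u, ?d x w] + \<psi> (\<tau> x) [?d x v, ?dd w u]" for u v w
    by (rule fun_cong)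
  have sym: "?dd u v = ?dd v u" for u v
    using \<tau>(1) by (intro second_derivative_symmetric[OF S]) (simp add: smooth_on_def)
  show ?thesis
    using local_form_on_swap[OF \<psi> T[OF S(2)], of "?d x v" "?dd u w"]
    by (simp add: local_ext_deriv_triple D sym[of v u] sym[of w u] sym[of w v])
qed

text \<open>The Leibniz rule \<open>d(e\<^sup>-\<^sup>F h) = e\<^sup>-\<^sup>F (dh - dF \<and> h)\<close>, with the wedge product written out.\<close>

lemma local_ext_deriv_exp_mult:
  assumes F: "(F has_derivative F') (at x)"
    and h: "\<And>i. i < length vs \<Longrightarrow> (\<lambda>y. h y (omit i vs)) differentiable (at x)"
  shows "local_ext_deriv (\<lambda>y as. exp (- F y) * h y as) x vs =
    exp (- F x) * (local_ext_deriv h x vs - (\<Sum>i<length vs. (-1) ^ i * F' (vs ! i) * h x (omit i vs)))"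
proof -
  have "frechet_derivative (\<lambda>y. exp (- F y) * h y (omit i vs)) (at x) (vs ! i) =
      exp (- F x) * (frechet_derivative (\<lambda>y. h y (omit i vs)) (at x) (vs ! i) - F' (vs ! i) * h x (omit i vs))"
    if "i < length vs" for i
  proof -
    have "((\<lambda>y. exp (- F y) * h y (omit i vs)) has_derivative
        (\<lambda>v. exp (- F x) * (frechet_derivative (\<lambda>y. h y (omit i vs)) (at x) v - F' v * h x (omit i vs)))) (at x)"
      using h[OF that, unfolded frechet_derivative_works]
      by (auto intro!: derivative_eq_intros F simp: algebra_simps)
    from fun_cong[OF frechet_derivative_at[OF this, symmetric]] show ?thesis .
  qed
  then show ?thesis
    by (simp add: local_ext_deriv_def sum_distrib_left flip: sum_subtractf) (simp add: algebra_simps)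
qed

section \<open>Tangent vectors and exterior derivative in charts\<close>

lemma smooth_form_on_iff_local:
  "smooth_form_on A U k \<omega> \<longleftrightarrow>
    (\<forall>c\<in>A. local_form_on (cmap c ` (U \<inter> cdom c)) k (form_coord A c \<omega>))"
  by (simp add: smooth_form_on_def local_form_on_def)

locale smooth_atlas =
  fixes M :: "'a topology" and A :: "('a, 'v::euclidean_space) chart set"
  assumes manifold: "smooth_manifold M A"
begin

lemma chart: "c \<in> A \<Longrightarrow> is_chart M c"
  using manifold unfolding smooth_manifold_def by blast

lemma openin_cdom: "c \<in> A \<Longrightarrow> openin M (cdom c)"
  using chart[of c] by (simp add: is_chart_def)

lemma cdom_subset: "c \<in> A \<Longrightarrow> cdom c \<subseteq> topspace M"
  by (rule openin_subset[OF openin_cdom])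

lemma charts_at_iff: "c \<in> charts_at A p \<longleftrightarrow> c \<in> A \<and> p \<in> cdom c"
  by (simp add: charts_at_def)

lemma ex_chart_at: "p \<in> topspace M \<Longrightarrow> \<exists>c. c \<in> charts_at A p"
  using manifold unfolding smooth_manifold_def charts_at_def by blast

lemma some_chart_at: "p \<in> topspace M \<Longrightarrow> (SOME c. c \<in> charts_at A p) \<in> charts_at A p"
  using ex_chart_at by (rule someI_ex)

lemma chart_homeomorphic:
  "c \<in> A \<Longrightarrow> homeomorphic_map (subtopology M (cdom c)) (top_of_set (cmap c ` cdom c)) (cmap c)"
  using chart by (simp add: is_chart_def)

lemma topspace_cdom: "c \<in> A \<Longrightarrow> topspace (subtopology M (cdom c)) = cdom c"
  using cdom_subset[of c] by auto

lemma inj_on_cmap: "c \<in> A \<Longrightarrow> inj_on (cmap c) (cdom c)"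
  using homeomorphic_imp_injective_map[OF chart_homeomorphic] topspace_cdom by metis

lemma cinv_cmap [simp]: "c \<in> A \<Longrightarrow> p \<in> cdom c \<Longrightarrow> cinv c (cmap c p) = p"
  using inj_on_cmap by (rule inv_into_f_f)

lemma open_cmap_image:
  assumes "c \<in> A" "openin M U"
  shows "open (cmap c ` (U \<inter> cdom c))"
proof -
  have "openin (subtopology M (cdom c)) (U \<inter> cdom c)"
    using assms(2) by (auto simp: openin_subtopology)
  then have "openin (top_of_set (cmap c ` cdom c)) (cmap c ` (U \<inter> cdom c))"
    using homeomorphic_imp_open_map[OF chart_homeomorphic[OF assms(1)]] by (simp add: open_map_def)
  then show ?thesis
    using chart[OF assms(1)] openin_open_trans unfolding is_chart_def by blast
qed

lemma open_overlap:
  assumes "c \<in> A" "c' \<in> A"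
  shows "open (cmap c ` (cdom c \<inter> cdom c'))"
  using open_cmap_image[OF assms(1) openin_cdom[OF assms(2)]] by (simp add: Int_commute)

lemma openin_cmap_vimage:
  assumes "c \<in> A" "open S"
  shows "openin M {p \<in> cdom c. cmap c p \<in> S}"
proof -
  have "continuous_map (subtopology M (cdom c)) euclidean (cmap c)"
    using homeomorphic_imp_continuous_map[OF chart_homeomorphic[OF assms(1)]]
    by (simp add: continuous_map_in_subtopology)
  from openin_continuous_map_preimage[OF this, of S] assms(2)
  have "openin (subtopology M (cdom c)) {p \<in> cdom c. cmap c p \<in> S}"
    by (simp only: topspace_cdom[OF assms(1)] open_openin)
  then show ?thesis
    by (rule openin_trans_full) (rule openin_cdom[OF assms(1)])
qed

lemma transition_smooth:
  "c \<in> A \<Longrightarrow> c' \<in> A \<Longrightarrow> smooth_on (cmap c ` (cdom c \<inter> cdom c')) (cmap c' \<circ> cinv c)"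
  using manifold unfolding smooth_manifold_def smooth_transition_def by blast

lemma transition_has_derivative:
  assumes "c \<in> charts_at A p" "c' \<in> charts_at A p"
  shows "((cmap c' \<circ> cinv c) has_derivative frechet_derivative (cmap c' \<circ> cinv c) (at (cmap c p)))
    (at (cmap c p))"
  using assms by (intro smooth_on_has_derivative[OF transition_smooth]) (auto simp: charts_at_iff)

lemma transition_derivative_compose:
  assumes "c \<in> charts_at A p" "c' \<in> charts_at A p" "c'' \<in> charts_at A p"
  shows "frechet_derivative (cmap c'' \<circ> cinv c) (at (cmap c p)) a =
    frechet_derivative (cmap c'' \<circ> cinv c') (at (cmap c' p))
      (frechet_derivative (cmap c' \<circ> cinv c) (at (cmap c p)) a)"
proof -
  note A = assms[unfolded charts_at_iff]
  have "((\<lambda>x. (cmap c'' \<circ> cinv c') ((cmap c' \<circ> cinv c) x)) has_derivative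
      (\<lambda>a. frechet_derivative (cmap c'' \<circ> cinv c') (at (cmap c' p))
        (frechet_derivative (cmap c' \<circ> cinv c) (at (cmap c p)) a))) (at (cmap c p))"
  proof (rule has_derivative_compose[OF transition_has_derivative[OF assms(1,2)]])
    have "(cmap c' \<circ> cinv c) (cmap c p) = cmap c' p"
      using A by simp
    then show "((cmap c'' \<circ> cinv c') has_derivative
        frechet_derivative (cmap c'' \<circ> cinv c') (at (cmap c' p))) (at ((cmap c' \<circ> cinv c) (cmap c p)))"
      using transition_has_derivative[OF assms(2,3)] by (simp only:)
  qed
  then have "((cmap c'' \<circ> cinv c) has_derivative
      (\<lambda>a. frechet_derivative (cmap c'' \<circ> cinv c') (at (cmap c' p))
        (frechet_derivative (cmap c' \<circ> cinv c) (at (cmap c p)) a))) (at (cmap c p))"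
    by (rule has_derivative_transform_within_open[OF _ open_overlap[of c c']]) (use A in auto)
  from fun_cong[OF frechet_derivative_at[OF this, symmetric]] show ?thesis .
qed

lemma transition_derivative_self:
  assumes "c \<in> charts_at A p"
  shows "frechet_derivative (cmap c \<circ> cinv c) (at (cmap c p)) a = a"
proof -
  note A = assms[unfolded charts_at_iff]
  have "((cmap c \<circ> cinv c) has_derivative (\<lambda>a. a)) (at (cmap c p))"
    by (rule has_derivative_transform_within_open[OF has_derivative_ident open_overlap[of c c]])
      (use A in auto)
  from fun_cong[OF frechet_derivative_at[OF this, symmetric]] show ?thesis .
qed

lemma coord_vec_apply:
  "c' \<in> charts_at A p \<Longrightarrow>
    coord_vec A c p a c' = frechet_derivative (cmap c' \<circ> cinv c) (at (cmap c p)) a"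
  by (simp add: coord_vec_def)

lemma coord_vec_self: "c \<in> charts_at A p \<Longrightarrow> coord_vec A c p a c = a"
  by (simp add: coord_vec_def transition_derivative_self)

lemma coord_vec_in_tangent_space:
  assumes "c \<in> charts_at A p"
  shows "coord_vec A c p a \<in> tangent_space A p"
  unfolding tangent_space_def mem_Collect_eq
proof (intro conjI ballI allI impI)
  fix c' c'' assume c': "c' \<in> charts_at A p" and c'': "c'' \<in> charts_at A p"
  show "coord_vec A c p a c'' =
      frechet_derivative (cmap c'' \<circ> cinv c') (at (cmap c' p)) (coord_vec A c p a c')"
    unfolding coord_vec_apply[OF c'] coord_vec_apply[OF c'']
    by (rule transition_derivative_compose[OF assms c' c''])
qed (simp add: coord_vec_def)

lemma tangent_component_change_chart:
  assumes "X \<in> tangent_space A p" "c \<in> charts_at A p" "c' \<in> charts_at A p"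
  shows "X c' = frechet_derivative (cmap c' \<circ> cinv c) (at (cmap c p)) (X c)"
  using assms unfolding tangent_space_def by blast

lemma coord_vec_of_component:
  assumes "X \<in> tangent_space A p" "c \<in> charts_at A p"
  shows "coord_vec A c p (X c) = X"
proof
  fix c'
  show "coord_vec A c p (X c) c' = X c'"
  proof (cases "c' \<in> charts_at A p")
    case True
    then show ?thesis
      by (simp only: coord_vec_apply tangent_component_change_chart[OF assms True])
  next
    case False
    then have "X c' = 0"
      using assms(1) unfolding tangent_space_def by blast
    with False show ?thesis
      by (simp add: coord_vec_def)
  qed
qed

lemma coord_vec_change_chart:
  assumes "c \<in> charts_at A p" "c' \<in> charts_at A p"
  shows "coord_vec A c p a =
    coord_vec A c' p (frechet_derivative (cmap c' \<circ> cinv c) (at (cmap c p)) a)"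
  using coord_vec_of_component[OF coord_vec_in_tangent_space[OF assms(1)] assms(2), of a]
  by (simp add: coord_vec_apply[OF assms(2)])

lemma form_coord_at:
  assumes "c \<in> charts_at A p"
  shows "form_coord A c \<omega> (cmap c p) as = \<omega> p (map (coord_vec A c p) as)"
  using assms by (simp add: form_coord_def charts_at_iff)

lemma form_coord_components:
  assumes "c \<in> charts_at A p" "set Xs \<subseteq> tangent_space A p"
  shows "form_coord A c \<omega> (cmap c p) (map (\<lambda>X. X c) Xs) = \<omega> p Xs"
proof -
  have "map (coord_vec A c p \<circ> (\<lambda>X. X c)) Xs = Xs"
    using assms(2) coord_vec_of_component[OF _ assms(1)] by (intro map_idI) auto
  then show ?thesis
    by (simp add: form_coord_at[OF assms(1)])
qed

text \<open>The coordinate vector of \<open>c\<close> with component \<open>v\<close> is that of \<open>c'\<close> with component \<open>D\<tau>(v)\<close>, so the two local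
  expressions are pullbacks of each other under the transition maps.\<close>

lemma form_coord_change_chart:
  assumes "c \<in> A" "c' \<in> A" "y \<in> cmap c ` (cdom c \<inter> cdom c')"
  shows "form_coord A c \<omega> y vs = form_coord A c' \<omega> ((cmap c' \<circ> cinv c) y)
    (map (frechet_derivative (cmap c' \<circ> cinv c) (at y)) vs)"
proof -
  obtain p where p: "y = cmap c p" "c \<in> charts_at A p" "c' \<in> charts_at A p"
    using assms by (auto simp: charts_at_iff)
  have "map (coord_vec A c p) vs =
      map (coord_vec A c' p) (map (frechet_derivative (cmap c' \<circ> cinv c) (at y)) vs)"
    unfolding map_map p(1) by (intro map_cong refl) (simp only: o_apply coord_vec_change_chart[OF p(2,3)])
  moreover have "(cmap c' \<circ> cinv c) y = cmap c' p"
    using p assms(1) by (simp add: charts_at_iff)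
  ultimately show ?thesis
    using form_coord_at[OF p(2), of \<omega> vs] form_coord_at[OF p(3)] by (simp only: p(1))
qed

lemma ext_deriv_in_some_chart:
  assumes "c = (SOME c. c \<in> charts_at A p)"
  shows "ext_deriv A \<omega> p Xs =
    local_ext_deriv (form_coord A c \<omega>) (cmap c p) (map (\<lambda>X. X c) Xs)"
  unfolding ext_deriv_def Let_def local_ext_deriv_def assms[symmetric]
  by (simp add: map_omit)

text \<open>The transition map to the chart selected in the definition of \<^const>\<open>ext_deriv\<close> pulls the local
  expression of \<open>\<omega>\<close> there back to the one in \<open>c\<close>, so that naturality under pullback applies.\<close>

lemma ext_deriv_in_chart:
  assumes k: "k = 1 \<or> k = 2" and \<omega>: "smooth_form_on A U k \<omega>" and U: "openin M U" "p \<in> U"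
    and c: "c \<in> charts_at A p" and Xs: "set Xs \<subseteq> tangent_space A p" "length Xs = Suc k"
  shows "ext_deriv A \<omega> p Xs =
    local_ext_deriv (form_coord A c \<omega>) (cmap c p) (map (\<lambda>X. X c) Xs)"
proof -
  define c' where "c' = (SOME c. c \<in> charts_at A p)"
  have c': "c' \<in> charts_at A p"
    using U openin_subset[OF U(1)] some_chart_at unfolding c'_def by blast
  let ?\<tau> = "cmap c' \<circ> cinv c"
  define S where "S = cmap c ` (cdom c \<inter> cdom c' \<inter> U)"
  have A: "c \<in> A" "c' \<in> A" "p \<in> cdom c" "p \<in> cdom c'"
    using c c' by (auto simp: charts_at_iff)
  have "openin M (cdom c' \<inter> U)"
    using A U openin_cdom by (intro openin_Int)
  from open_cmap_image[OF A(1) this] have S: "open S" "cmap c p \<in> S"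
    using A U by (auto simp: S_def Int_ac)
  have S_sub: "S \<subseteq> cmap c ` (cdom c \<inter> cdom c')"
    by (auto simp: S_def)
  have \<tau>: "smooth_on S ?\<tau>" "?\<tau> ` S \<subseteq> cmap c' ` (U \<inter> cdom c')"
    using smooth_on_subset[OF transition_smooth[OF A(1,2)] S_sub] A by (auto simp: S_def)
  have \<psi>: "local_form_on (cmap c' ` (U \<inter> cdom c')) k (form_coord A c' \<omega>)"
    using \<omega> A by (simp add: smooth_form_on_iff_local)
  have change: "form_coord A c \<omega> y vs = form_coord A c' \<omega> (?\<tau> y) (map (frechet_derivative ?\<tau> (at y)) vs)"
    if "y \<in> S" for y vs
    using that S_sub by (intro form_coord_change_chart A) auto
  have comps: "map (frechet_derivative ?\<tau> (at (cmap c p))) (map (\<lambda>X. X c) Xs) = map (\<lambda>X. X c') Xs"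
    using Xs(1) tangent_component_change_chart[OF _ c c'] by auto
  have "local_ext_deriv (form_coord A c \<omega>) (cmap c p) vs =
      local_ext_deriv (form_coord A c' \<omega>) (?\<tau> (cmap c p)) (map (frechet_derivative ?\<tau> (at (cmap c p))) vs)"
    if "length vs = Suc k" for vs
    using k
  proof
    assume "k = 1"
    with that have "length vs = Suc (Suc 0)" by simp
    then obtain u v where vs: "vs = [u, v]"
      by (auto simp: length_Suc_conv)
    show ?thesis
      unfolding vs by (rule local_ext_deriv_pullback_1[OF S \<tau> \<psi>[unfolded \<open>k = 1\<close>]]) (rule change)
  next
    assume "k = 2"
    with that have "length vs = Suc (Suc (Suc 0))" by simp
    then obtain u v w where vs: "vs = [u, v, w]"
      by (auto simp: length_Suc_conv)
    show ?thesis
      unfolding vs by (rule local_ext_deriv_pullback_2[OF S \<tau> \<psi>[unfolded \<open>k = 2\<close>]]) (rule change)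
  qed
  from this[of "map (\<lambda>X. X c) Xs"] show ?thesis
    using Xs(2) A by (simp only: comps ext_deriv_in_some_chart[OF c'_def] length_map o_apply cinv_cmap)
qed

section \<open>Local potentials and the Leibniz rule\<close>

text \<open>The potential is found on a coordinate ball in a single chart. That its differential is \<open>\<alpha>\<close> is
  then asserted in every chart, since the Leibniz rule is applied in an uncontrolled one.\<close>

lemma closed_one_form_locally_exact:
  assumes \<alpha>: "closed_form_on A (topspace M) 1 \<alpha>" and p: "p \<in> topspace M"
  shows "\<exists>U f. openin M U \<and> p \<in> U \<and> smooth_fun_on A U f \<and>
    (\<forall>q\<in>U. \<forall>c\<in>charts_at A q.
      ((f \<circ> cinv c) has_derivative (\<lambda>v. \<alpha> q [coord_vec A c q v])) (at (cmap c q)))"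
proof -
  obtain c where c: "c \<in> charts_at A p"
    using ex_chart_at[OF p] by blast
  then have cA: "c \<in> A" "p \<in> cdom c"
    by (simp_all add: charts_at_iff)
  have "open (cmap c ` (topspace M \<inter> cdom c))"
    by (rule open_cmap_image[OF cA(1) openin_topspace])
  moreover have cmem: "cmap c p \<in> cmap c ` (topspace M \<inter> cdom c)"
    using cA p by blast
  ultimately obtain r where r: "0 < r" "ball (cmap c p) r \<subseteq> cmap c ` (topspace M \<inter> cdom c)"
    by (meson openE)
  define S where "S = ball (cmap c p) r"
  define a where "a y v = form_coord A c \<alpha> y [v]" for y v
  have \<alpha>c: "local_form_on S 1 (form_coord A c \<alpha>)"
    using \<alpha> cA(1) local_form_on_subset[OF _ r(2)]
    unfolding closed_form_on_def smooth_form_on_iff_local S_def by blast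
  have S: "open S" "convex S"
    by (simp_all add: S_def)
  have "\<exists>F. smooth_on S F \<and> (\<forall>y\<in>S. (F has_derivative a y) (at y))"
  proof (rule poincare_one_form_convex[OF S])
    show "linear (a y)" if "y \<in> S" for y
      unfolding a_def by (rule local_form_on_linear1[OF \<alpha>c that])
    show "smooth_on S (\<lambda>y. a y v)" for v
      using \<alpha>c by (simp add: a_def local_form_on_def)
    show "frechet_derivative (\<lambda>z. a z v) (at y) u = frechet_derivative (\<lambda>z. a z u) (at y) v"
      if y: "y \<in> S" for y u v
    proof -
      obtain q where q: "q \<in> topspace M" "q \<in> cdom c" "y = cmap c q"
        using y r(2) unfolding S_def by blast
      then have cq: "c \<in> charts_at A q"
        using cA(1) by (simp add: charts_at_iff)
      define Xs where "Xs = [coord_vec A c q u, coord_vec A c q v]"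
      have Xs: "set Xs \<subseteq> tangent_space A q" "length Xs = Suc 1"
        using coord_vec_in_tangent_space[OF cq] by (simp_all add: Xs_def)
      have "ext_deriv A \<alpha> q Xs = 0"
        using \<alpha> q(1) Xs unfolding closed_form_on_def form_eq_on_def by blast
      moreover have "ext_deriv A \<alpha> q Xs = local_ext_deriv (form_coord A c \<alpha>) y [u, v]"
        using ext_deriv_in_chart[OF _ _ openin_topspace q(1) cq Xs, of \<alpha>] \<alpha>
        by (simp add: closed_form_on_def Xs_def coord_vec_self[OF cq] q(3))
      ultimately show ?thesis
        by (simp add: local_ext_deriv_pair a_def)
    qed
  qed
  then obtain F where F: "smooth_on S F" "\<And>y. y \<in> S \<Longrightarrow> (F has_derivative a y) (at y)"
    by blast
  define U where "U = {q \<in> cdom c. cmap c q \<in> S}"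
  define f where "f q = F (cmap c q)" for q
  have U: "openin M U"
    unfolding U_def by (rule openin_cmap_vimage[OF cA(1) S(1)])
  have f_coord: "(f \<circ> cinv c') = (\<lambda>x. F ((cmap c \<circ> cinv c') x))" for c'
    by (simp add: f_def fun_eq_iff)
  have transition_S: "(cmap c \<circ> cinv c') ` (cmap c' ` (U \<inter> cdom c')) \<subseteq> S" if "c' \<in> A" for c'
    using cinv_cmap[OF that] by (auto simp: U_def)
  have "smooth_fun_on A U f"
    unfolding smooth_fun_on_def
  proof
    fix c' assume c': "c' \<in> A"
    have "cmap c' ` (U \<inter> cdom c') \<subseteq> cmap c' ` (cdom c' \<inter> cdom c)"
      by (auto simp: U_def)
    from smooth_on_compose[OF open_cmap_image[OF c' U] transition_S[OF c']
        smooth_on_subset[OF transition_smooth[OF c' cA(1)] this] F(1)]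
    show "smooth_on (cmap c' ` (U \<inter> cdom c')) (f \<circ> cinv c')"
      unfolding f_coord .
  qed
  moreover have "((f \<circ> cinv c') has_derivative (\<lambda>v. \<alpha> q [coord_vec A c' q v])) (at (cmap c' q))"
    if q: "q \<in> U" and c': "c' \<in> charts_at A q" for q c'
  proof -
    have cq: "c \<in> charts_at A q" and qS: "cmap c q \<in> S"
      using q cA(1) by (auto simp: U_def charts_at_iff)
    have [simp]: "(cmap c \<circ> cinv c') (cmap c' q) = cmap c q"
      using c' by (simp add: charts_at_iff)
    have "((\<lambda>x. F ((cmap c \<circ> cinv c') x)) has_derivative
        (\<lambda>v. a (cmap c q) (frechet_derivative (cmap c \<circ> cinv c') (at (cmap c' q)) v))) (at (cmap c' q))"
    proof (rule has_derivative_compose[OF transition_has_derivative[OF c' cq]])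
      show "(F has_derivative a (cmap c q)) (at ((cmap c \<circ> cinv c') (cmap c' q)))"
        using F(2)[OF qS] by (simp del: o_apply)
    qed
    moreover have "a (cmap c q) (frechet_derivative (cmap c \<circ> cinv c') (at (cmap c' q)) v) =
        \<alpha> q [coord_vec A c' q v]" for v
      by (simp add: a_def form_coord_at[OF cq] coord_vec_change_chart[OF c' cq, symmetric] del: o_apply)
    ultimately show ?thesis
      unfolding f_coord by simp
  qed
  moreover have "p \<in> U"
    using cA r(1) by (simp add: U_def S_def)
  ultimately show ?thesis
    using U by blast
qed

text \<open>The identity is pointwise, so at each point it suffices to compute in the chart that defines the
  exterior derivative there; the hypothesis on \<open>f\<close> says \<open>df = \<alpha>\<close> in every chart.\<close>

lemma ext_deriv_exp_mult:
  assumes \<omega>: "smooth_form_on A U k \<omega>" and U: "U \<subseteq> topspace M"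
    and f: "\<And>q c. q \<in> U \<Longrightarrow> c \<in> charts_at A q \<Longrightarrow>
      ((f \<circ> cinv c) has_derivative (\<lambda>v. \<alpha> q [coord_vec A c q v])) (at (cmap c q))"
  shows "form_eq_on A U (Suc k) (ext_deriv A (\<lambda>p Xs. exp (- f p) * \<omega> p Xs))
    (\<lambda>p Xs. exp (- f p) * (ext_deriv A \<omega> p Xs - wedge1 \<alpha> \<omega> p Xs))"
  unfolding form_eq_on_def
proof (intro ballI allI impI, elim conjE)
  fix q Xs assume q: "q \<in> U" and Xs: "length Xs = Suc k" "set Xs \<subseteq> tangent_space A q"
  define c where "c = (SOME c. c \<in> charts_at A q)"
  have c: "c \<in> charts_at A q"
    using some_chart_at q U unfolding c_def by blast
  then have cA: "c \<in> A" "q \<in> cdom c"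
    by (simp_all add: charts_at_iff)
  define x where "x = cmap c q"
  define vs where "vs = map (\<lambda>X. X c) Xs"
  define h where "h = form_coord A c \<omega>"
  have f_x: "(f \<circ> cinv c) x = f q"
    using cA by (simp add: x_def)
  have h: "local_form_on (cmap c ` (U \<inter> cdom c)) k h"
    using \<omega> cA(1) unfolding smooth_form_on_iff_local h_def by blast
  have x: "x \<in> cmap c ` (U \<inter> cdom c)"
    using q cA by (simp add: x_def)
  have diff: "(\<lambda>y. h y (omit i vs)) differentiable (at x)" if "i < length vs" for i
    using local_form_on_has_derivative[OF h x, of "omit i vs"] that Xs(1)
    by (auto simp: length_omit vs_def intro: differentiableI)
  have "ext_deriv A (\<lambda>p Xs. exp (- f p) * \<omega> p Xs) q Xs =
      local_ext_deriv (\<lambda>y as. exp (- (f \<circ> cinv c) y) * h y as) x vs"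
    unfolding ext_deriv_in_some_chart[OF c_def] x_def vs_def h_def
    by (simp add: form_coord_def[abs_def])
  also have "\<dots> = exp (- f q) * (local_ext_deriv h x vs -
      (\<Sum>i<length vs. (-1) ^ i * \<alpha> q [coord_vec A c q (vs ! i)] * h x (omit i vs)))"
    using local_ext_deriv_exp_mult[OF f[OF q c, folded x_def], of vs h] diff
    unfolding f_x by blast
  also have "local_ext_deriv h x vs = ext_deriv A \<omega> q Xs"
    unfolding ext_deriv_in_some_chart[OF c_def] x_def vs_def h_def ..
  also have "(\<Sum>i<length vs. (-1) ^ i * \<alpha> q [coord_vec A c q (vs ! i)] * h x (omit i vs)) = wedge1 \<alpha> \<omega> q Xs"
    unfolding wedge1_def
  proof (rule sum.cong)
    fix i assume i: "i \<in> {..<length Xs}"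
    then have "coord_vec A c q (vs ! i) = Xs ! i"
      using Xs(2) coord_vec_of_component[OF _ c] by (simp add: vs_def subset_iff)
    moreover have "h x (omit i vs) = \<omega> q (omit i Xs)"
      using form_coord_components[OF c, of "omit i Xs" \<omega>] set_omit[of i Xs] Xs(2)
      by (simp add: h_def x_def vs_def map_omit)
    ultimately show "(-1) ^ i * \<alpha> q [coord_vec A c q (vs ! i)] * h x (omit i vs) =
        (-1) ^ i * \<alpha> q [Xs ! i] * \<omega> q (omit i Xs)"
      by simp
  qed (simp add: vs_def)
  finally show "ext_deriv A (\<lambda>p Xs. exp (- f p) * \<omega> p Xs) q Xs =
      exp (- f q) * (ext_deriv A \<omega> q Xs - wedge1 \<alpha> \<omega> q Xs)" .
qed

lemma smooth_form_on_exp_mult: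
  assumes "openin M U" "smooth_fun_on A U f" "smooth_form_on A U k \<omega>"
  shows "smooth_form_on A U k (\<lambda>p Xs. exp (- f p) * \<omega> p Xs)"
  unfolding smooth_form_on_iff_local
proof
  fix c assume c: "c \<in> A"
  let ?S = "cmap c ` (U \<inter> cdom c)"
  have S: "open ?S"
    by (rule open_cmap_image[OF c assms(1)])
  have "smooth_on ?S (f \<circ> cinv c)"
    using assms(2) c unfolding smooth_fun_on_def by blast
  then have "smooth_on ?S (\<lambda>x. exp (- (f \<circ> cinv c) x))"
    by (intro smooth_on_exp smooth_on_minus S)
  moreover have "local_form_on ?S k (form_coord A c \<omega>)"
    using assms(3) c unfolding smooth_form_on_iff_local by blast
  ultimately have "local_form_on ?S k (\<lambda>x as. exp (- (f \<circ> cinv c) x) * form_coord A c \<omega> x as)"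
    by (rule local_form_on_scale[OF S])
  then show "local_form_on ?S k (form_coord A c (\<lambda>p Xs. exp (- f p) * \<omega> p Xs))"
    by (simp add: form_coord_def[abs_def])
qed

lemma smooth_form_on_subset:
  assumes "smooth_form_on A V k \<omega>" "U \<subseteq> V"
  shows "smooth_form_on A U k \<omega>"
  unfolding smooth_form_on_iff_local
proof
  fix c assume "c \<in> A"
  then have "local_form_on (cmap c ` (V \<inter> cdom c)) k (form_coord A c \<omega>)"
    using assms(1) unfolding smooth_form_on_iff_local by blast
  then show "local_form_on (cmap c ` (U \<inter> cdom c)) k (form_coord A c \<omega>)"
    by (rule local_form_on_subset) (use assms(2) in blast)
qed

end

section \<open>Smoothness of the Bismut torsion\<close>

definition endo_coord ::
    "('a, 'v::euclidean_space) chart set \<Rightarrow> ('a, 'v) chart \<Rightarrow> ('a, 'v) endo_field \<Rightarrow> 'v \<Rightarrow> 'v \<Rightarrow> 'v" where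
  "endo_coord A c J x v = J (cinv c x) (coord_vec A c (cinv c x) v) c"

context smooth_atlas
begin

lemma endo_coord_at:
  assumes "c \<in> charts_at A p"
  shows "endo_coord A c J (cmap c p) v = J p (coord_vec A c p v) c"
  using assms by (simp add: endo_coord_def charts_at_iff)

lemma endo_coord_linear:
  assumes "almost_complex_structure M A J" "c \<in> A" "x \<in> cmap c ` cdom c"
  shows "linear (endo_coord A c J x)"
proof -
  obtain p where p: "p \<in> cdom c" "x = cmap c p"
    using assms(3) by blast
  have "linear (\<lambda>a. J p (coord_vec A c p a) c)"
    using assms(1,2) p(1) unfolding almost_complex_structure_def by blast
  then show ?thesis
    using p assms(2) by (simp add: endo_coord_def[abs_def])
qed

lemma endo_coord_smooth:
  assumes "almost_complex_structure M A J" "c \<in> A"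
  shows "smooth_on (cmap c ` cdom c) (\<lambda>x. endo_coord A c J x v)"
  using assms unfolding almost_complex_structure_def endo_coord_def by blast

lemma endo_tangent:
  assumes "almost_complex_structure M A J" "X \<in> tangent_space A p" "p \<in> topspace M"
  shows "J p X \<in> tangent_space A p" "J p (J p X) = (\<lambda>c. - X c)"
  using assms unfolding almost_complex_structure_def by blast+

lemma endo_coord_vec:
  assumes "almost_complex_structure M A J" "c \<in> charts_at A p" "p \<in> topspace M"
  shows "J p (coord_vec A c p v) = coord_vec A c p (endo_coord A c J (cmap c p) v)"
  unfolding endo_coord_at[OF assms(2)]
  by (rule coord_vec_of_component[symmetric, OF
        endo_tangent(1)[OF assms(1) coord_vec_in_tangent_space[OF assms(2)] assms(3)] assms(2)])

text \<open>In a chart \<open>\<Omega>(a, b) = g(Ja, b)\<close>, which gives bilinearity and smoothness. It is alternating since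
  \<open>g(JX, X) = g(JJX, JX) = - g(X, JX) = - g(JX, X)\<close>.\<close>

lemma fundamental_form_smooth:
  assumes J: "almost_complex_structure M A J" and g: "riemannian_metric M A g"
    and compat: "\<And>p X Y. p \<in> topspace M \<Longrightarrow> X \<in> tangent_space A p \<Longrightarrow> Y \<in> tangent_space A p \<Longrightarrow>
      g p (J p X) (J p Y) = g p X Y"
  shows "smooth_form_on A (topspace M) 2 (fundamental_form J g)"
  unfolding smooth_form_on_iff_local
proof
  fix c assume c: "c \<in> A"
  define S where "S = cmap c ` cdom c"
  define G where "G x a b = g (cinv c x) (coord_vec A c (cinv c x) a) (coord_vec A c (cinv c x) b)" for x a b
  have domc: "topspace M \<inter> cdom c = cdom c"
    using cdom_subset[OF c] by blast
  have S: "open S"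
    using open_cmap_image[OF c openin_topspace] unfolding domc S_def .
  have at: "\<exists>p. p \<in> topspace M \<and> p \<in> cdom c \<and> c \<in> charts_at A p \<and> x = cmap c p" if "x \<in> S" for x
    using that cdom_subset[OF c] c unfolding S_def charts_at_iff by blast
  have \<Omega>: "form_coord A c (fundamental_form J g) x [a, b] = G x (endo_coord A c J x a) b"
    if x: "x \<in> S" for x a b
  proof -
    obtain p where p: "p \<in> topspace M" "p \<in> cdom c" "c \<in> charts_at A p" "x = cmap c p"
      using at[OF x] by blast
    then show ?thesis
      using c by (simp add: form_coord_at fundamental_form_def G_def endo_coord_vec[OF J p(3,1)])
  qed
  have G: "bilinear (G x)" if x: "x \<in> S" for x
  proof -
    obtain p where p: "p \<in> cdom c" "x = cmap c p"
      using at[OF x] by blast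
    have "bilinear (\<lambda>a b. g p (coord_vec A c p a) (coord_vec A c p b))"
      using g c p(1) unfolding riemannian_metric_def by blast
    then show ?thesis
      using c p by (simp add: G_def[abs_def])
  qed
  have Jlin: "linear (endo_coord A c J x)" if "x \<in> S" for x
    using endo_coord_linear[OF J c] that unfolding S_def .
  have "local_form_on S 2 (form_coord A c (fundamental_form J g))"
    unfolding local_form_on_def
  proof (intro conjI ballI allI impI)
    fix x assume x: "x \<in> S"
    show "multilinear_form 2 (form_coord A c (fundamental_form J g) x)"
    proof (rule multilinear_formI)
      fix as bs :: "'v list" assume "length as + Suc (length bs) = 2"
      then consider b where "as = []" "bs = [b]" | b where "as = [b]" "bs = []"
        by (cases as; cases bs) auto
      then show "linear (\<lambda>a. form_coord A c (fundamental_form J g) x (as @ a # bs))"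
        using G[OF x] linear_compose[OF Jlin[OF x], of "\<lambda>a. G x a b" for b]
        by cases (simp_all add: \<Omega>[OF x] bilinear_def o_def)
    qed
    show "alternating_form 2 (form_coord A c (fundamental_form J g) x)"
      unfolding alternating_form_def
    proof (intro allI impI)
      fix as :: "'v list" and i j :: nat
      assume *: "length as = 2 \<and> i < j \<and> j < 2 \<and> as ! i = as ! j"
      then have ij: "i = 0" "j = 1" by auto
      from * have "length as = Suc (Suc 0)" by simp
      then obtain a b where "as = [a, b]"
        by (auto simp: length_Suc_conv)
      with * ij have as: "as = [a, a]" by simp
      obtain p where p: "p \<in> topspace M" "p \<in> cdom c" "c \<in> charts_at A p" "x = cmap c p"
        using at[OF x] by blast
      let ?X = "coord_vec A c p a"
      have X: "?X \<in> tangent_space A p"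
        by (rule coord_vec_in_tangent_space[OF p(3)])
      have JX: "J p ?X \<in> tangent_space A p" and JJX: "J p (J p ?X) \<in> tangent_space A p"
        using endo_tangent(1)[OF J _ p(1)] X by blast+
      have "J p (J p ?X) = coord_vec A c p (- a)"
        using coord_vec_of_component[OF JJX p(3)] endo_tangent(2)[OF J X p(1)]
        by (simp add: coord_vec_self[OF p(3)])
      then have "g p (J p ?X) ?X = G x (- a) (endo_coord A c J x a)"
        using compat[OF p(1) JX X] p c by (simp add: G_def endo_coord_vec[OF J p(3,1)])
      also have "\<dots> = - G x a (endo_coord A c J x a)"
        using bilinear_lneg[OF G[OF x]] by simp
      also have "\<dots> = - g p ?X (J p ?X)"
        using p c by (simp add: G_def endo_coord_vec[OF J p(3,1)])
      also have "g p ?X (J p ?X) = g p (J p ?X) ?X"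
        using g p(1) X JX unfolding riemannian_metric_def by blast
      finally have "g p (J p ?X) ?X = 0" by simp
      then show "form_coord A c (fundamental_form J g) x as = 0"
        using p(3) by (simp add: as p(4) form_coord_at fundamental_form_def)
    qed
  next
    fix as :: "'v list" assume "length as = 2"
    then have "length as = Suc (Suc 0)" by simp
    then obtain a b where as: "as = [a, b]"
      by (auto simp: length_Suc_conv)
    have "smooth_on S (\<lambda>x. G x (endo_coord A c J x a) b)"
    proof (rule smooth_on_linear_apply[OF S, where a = "\<lambda>x v. G x v b"])
      show "linear (\<lambda>v. G x v b)" if "x \<in> S" for x
        using G[OF that] by (simp add: bilinear_def)
      show "smooth_on S (\<lambda>x. G x v b)" for v
        using g c unfolding riemannian_metric_def G_def S_def by blast
      show "smooth_on S (\<lambda>x. endo_coord A c J x a)"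
        unfolding S_def by (rule endo_coord_smooth[OF J c])
    qed
    then show "smooth_on S (\<lambda>x. form_coord A c (fundamental_form J g) x as)"
      by (rule smooth_on_cong[OF S, rotated]) (simp add: as \<Omega>)
  qed
  then show "local_form_on (cmap c ` (topspace M \<inter> cdom c)) 2 (form_coord A c (fundamental_form J g))"
    unfolding domc S_def .
qed

text \<open>By independence of the chart, the local expression of \<open>H\<close> in \<open>c\<close> is minus the exterior derivative
  of the local expression of \<open>\<Omega>\<close> in the same chart \<open>c\<close>, with \<open>J\<close> inserted into all three slots.\<close>

lemma bismut_torsion_smooth:
  assumes J: "almost_complex_structure M A J"
    and \<Omega>: "smooth_form_on A (topspace M) 2 (fundamental_form J g)"
  shows "smooth_form_on A (topspace M) 3 (bismut_torsion A J g)"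
  unfolding smooth_form_on_iff_local
proof
  fix c assume c: "c \<in> A"
  define S where "S = cmap c ` (topspace M \<inter> cdom c)"
  have S: "open S"
    unfolding S_def by (rule open_cmap_image[OF c openin_topspace])
  have S_sub: "S \<subseteq> cmap c ` cdom c"
    unfolding S_def by blast
  have "local_form_on S 2 (form_coord A c (fundamental_form J g))"
    using \<Omega> c unfolding smooth_form_on_iff_local S_def by blast
  then have "local_form_on S 3 (\<lambda>x vs. local_ext_deriv (form_coord A c (fundamental_form J g)) x
      (map (endo_coord A c J x) vs))"
    using endo_coord_linear[OF J c] endo_coord_smooth[OF J c] S_sub
    by (intro local_form_on_map_endomorphism[OF S local_form_on_ext_deriv[OF S]])
      (auto intro: smooth_on_subset)
  then have "local_form_on S 3 (\<lambda>x vs. - 1 * local_ext_deriv (form_coord A c (fundamental_form J g)) x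
      (map (endo_coord A c J x) vs))"
    by (rule local_form_on_scale[OF S smooth_on_const])
  then have "local_form_on S 3 (form_coord A c (bismut_torsion A J g))"
  proof (rule local_form_on_cong[OF S, rotated])
    fix x and vs :: "'v list" assume "x \<in> S" and len: "length vs = 3"
    then obtain p where p: "p \<in> topspace M" "p \<in> cdom c" "x = cmap c p"
      unfolding S_def by blast
    then have cp: "c \<in> charts_at A p"
      using c by (simp add: charts_at_iff)
    define Xs where "Xs = map (J p) (map (coord_vec A c p) vs)"
    have Xs: "set Xs \<subseteq> tangent_space A p" "length Xs = Suc 2"
      using endo_tangent(1)[OF J coord_vec_in_tangent_space[OF cp] p(1)] len by (auto simp: Xs_def)
    have "map (\<lambda>X. X c) Xs = map (endo_coord A c J x) vs"
      by (simp add: Xs_def p(3) endo_coord_at[OF cp])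
    then have "ext_deriv A (fundamental_form J g) p Xs =
        local_ext_deriv (form_coord A c (fundamental_form J g)) x (map (endo_coord A c J x) vs)"
      using ext_deriv_in_chart[OF disjI2[OF refl] \<Omega> openin_topspace p(1) cp Xs] p(3) by simp
    then show "- 1 * local_ext_deriv (form_coord A c (fundamental_form J g)) x (map (endo_coord A c J x) vs) =
        form_coord A c (bismut_torsion A J g) x vs"
      by (simp add: p(3) form_coord_at[OF cp] bismut_torsion_def Xs_def)
  qed
  then show "local_form_on (cmap c ` (topspace M \<inter> cdom c)) 3 (form_coord A c (bismut_torsion A J g))"
    unfolding S_def .
qed

end

section \<open>Locally conformal SKT manifolds\<close>

theorem proposition2p1:
  fixes M :: "'a topology"
    and A :: "('a, complex ^ 'n) chart set"
    and J :: "('a, complex ^ 'n) endo_field"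
    and g :: "('a, complex ^ 'n) metric_field"
  assumes "LCSKT M A J g"
  shows "\<exists>(\<U> :: 'a set set) (f :: 'a set \<Rightarrow> 'a \<Rightarrow> real).
           (\<forall>U\<in>\<U>. openin M U) \<and> \<Union>\<U> = topspace M \<and>
           (\<forall>U\<in>\<U>. smooth_fun_on A U (f U) \<and>
              closed_form_on A U 3 (\<lambda>p Xs. exp (- f U p) * bismut_torsion A J g p Xs))"
proof -
  let ?H = "bismut_torsion A J g"
  have herm: "hermitian_manifold M A J g"
    using assms by (simp add: LCSKT_def)
  obtain \<alpha> where \<alpha>: "closed_form_on A (topspace M) 1 \<alpha>"
    and dH: "form_eq_on A (topspace M) 4 (ext_deriv A ?H) (wedge1 \<alpha> ?H)"
    using assms unfolding LCSKT_def by blast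
  interpret smooth_atlas M A
    using herm by unfold_locales (simp add: hermitian_manifold_def)
  have J: "almost_complex_structure M A J"
    using herm by (simp add: hermitian_manifold_def complex_structure_def)
  have "smooth_form_on A (topspace M) 2 (fundamental_form J g)"
    using herm unfolding hermitian_manifold_def by (intro fundamental_form_smooth[OF J]) blast+
  then have H: "smooth_form_on A (topspace M) 3 ?H"
    by (rule bismut_torsion_smooth[OF J])
  define good where "good U f \<longleftrightarrow> openin M U \<and> smooth_fun_on A U f \<and>
      closed_form_on A U 3 (\<lambda>p Xs. exp (- f p) * ?H p Xs)" for U f
  have good_cover: "\<exists>U f. p \<in> U \<and> good U f" if p: "p \<in> topspace M" for p
  proof -
    obtain U f where U: "openin M U" "p \<in> U" and f: "smooth_fun_on A U f"
      and df: "\<And>q c. q \<in> U \<Longrightarrow> c \<in> charts_at A q \<Longrightarrow>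
        ((f \<circ> cinv c) has_derivative (\<lambda>v. \<alpha> q [coord_vec A c q v])) (at (cmap c q))"
      using closed_one_form_locally_exact[OF \<alpha> p] by blast
    have sub: "U \<subseteq> topspace M"
      by (rule openin_subset[OF U(1)])
    have HU: "smooth_form_on A U 3 ?H"
      by (rule smooth_form_on_subset[OF H sub])
    have "form_eq_on A U (Suc 3) (ext_deriv A (\<lambda>p Xs. exp (- f p) * ?H p Xs)) (\<lambda>p Xs. 0)"
      using ext_deriv_exp_mult[OF HU sub df] dH sub
      unfolding form_eq_on_def by (simp add: subset_iff)
    then have "good U f"
      unfolding good_def closed_form_on_def
      using U(1) f smooth_form_on_exp_mult[OF U(1) f HU] by blast
    with U(2) show ?thesis by blast
  qed
  have good_open: "openin M U" if "good U f" for U f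
    using that by (simp add: good_def)
  have cover: "\<Union>{U. \<exists>f. good U f} = topspace M"
  proof (intro equalityI Union_least subsetI)
    show "p \<in> topspace M" if "U \<in> {U. \<exists>f. good U f}" "p \<in> U" for U p
      using that openin_subset[OF good_open] by blast
    show "p \<in> \<Union>{U. \<exists>f. good U f}" if "p \<in> topspace M" for p
      using good_cover[OF that] by blast
  qed
  define F where "F U = (SOME f. good U f)" for U
  have F: "good U (F U)" if "U \<in> {U. \<exists>f. good U f}" for U
    unfolding F_def using that by (intro someI_ex[of "good U"]) blast
  show ?thesis
  proof (intro exI[of _ "{U. \<exists>f. good U f}"] exI[of _ F] conjI ballI cover)
    fix U assume "U \<in> {U. \<exists>f. good U f}"
    from F[OF this] show "openin M U" "smooth_fun_on A U (F U)"
      "closed_form_on A U 3 (\<lambda>p Xs. exp (- F U p) * bismut_torsion A J g p Xs)"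
      by (simp_all only: good_def)
  qed
qed

end
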